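(* Let $(A,\cdot_{A},\Delta,P,Q)$ be a commutative and cocommutative differential ASI bialgebra. Let $(A,\circ_{A})$ be the anti-pre-Lie algebra given by $x\circ_A y=Q(x\cdot_A y)-P(x)\cdot_A y$ for all $x,y\in A$, and let $\theta:A\rightarrow A\otimes A$ be the linear map given by $$\theta(x)=\Delta\big(P(x)\big)-(Q\otimes\mathrm{id})\Delta(x),\quad\forall x\in A.$$ Then $(A,\cdot_{A},\circ_{A},\Delta,\theta,P,Q)$ is a relative PCA bialgebra.
   Context: All vector spaces are finite-dimensional over an algebraically closed field $\mathbb K$ of characteristic zero. $\mathcal{L}_{\diamond}(x)y=x\diamond y$, $\mathcal{R}_{\diamond}(x)y=y\diamond x$, $\mathrm{ad}(x)y=[x,y]$; $\tau(x\otimes y)=y\otimes x$, $\xi(x\otimes y\otimes z)=y\otimes z\otimes x$. Cocommutative coassociative coalgebra: $(A,\Delta)$ with $\tau\Delta=\Delta$ and $(\mathrm{id}\otimes\Delta)\Delta=(\Delta\otimes\mathrm{id})\Delta$. Commutative and cocommutative ASI bialgebra: $(A,\cdot,\Delta)$ with $(A,\cdot)$ commutative associative, $(A,\Delta)$ cocommutative coassociative, and $\Delta(x\cdot y)=(\mathcal{L}_{\cdot}(x)\otimes\mathrm{id})\Delta(y)+(\mathrm{id}\otimes\mathcal{L}_{\cdot}(y))\Delta(x)$. Commutative and cocommutative differential ASI bialgebra: $(A,\cdot,\Delta,P,Q)$ such that $(A,\cdot,\Delta)$ is a commutative and cocommutative ASI bialgebra; $(A,\cdot,P,Q)$ is an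 admissible commutative differential algebra, i.e. $P$ is a derivation of $(A,\cdot)$ and $x\cdot Q(y)-P(x)\cdot y-Q(x\cdot y)=0$ for all $x,y$; and $(A,\Delta,Q,P)$ is an admissible cocommutative differential coalgebra, i.e. $\Delta Q=(Q\otimes\mathrm{id}+\mathrm{id}\otimes Q)\Delta$ and $\Delta P=(\mathrm{id}\otimes P-Q\otimes\mathrm{id})\Delta$. Relative Poisson algebra: $(A,\cdot,[-,-],P)$ with $(A,\cdot)$ commutative associative, $(A,[-,-])$ a Lie algebra, $P$ a derivation of both, and $[z,x\cdot y]=[z,x]\cdot y+x\cdot[z,y]+x\cdot y\cdot P(z)$. Anti-pre-Lie algebra: $(A,\circ)$ such that, with $[x,y]=x\circ y-y\circ x$, $x\circ(y\circ z)-y\circ(x\circ z)=[y,x]\circ z$ and $[x,y]\circ z+[y,z]\circ x+[z,x]\circ y=0$; $(A,[-,-])$ is then a Lie algebra (the sub-adjacent Lie algebra). Relative PCA algebra: $(A,\cdot,\circ,P,Q)$ with $(A,\cdot)$ commutative associative, $(A,\circ)$ anti-pre-Lie with sub-adjacent Lie algebra $(A,[-,-])$, $P,Q:A\to A$ linear, $(A,\cdot,[-,-],P)$ a relative Poisson algebra, and: $x\cdot Q(y)-P(x)\cdot y-Q(x\cdot y)=0$; $x\circ Q(y)-P(x)\circ y-Q(x\circ y)=0$; $x\cdot(y\circ z)-y\circ(x\cdot z)+[x,y]\cdot z-x\cdot P(y)\cdot z=0$; $(x\cdot y)\circ z-y\circ(x\cdot z)-x\circ(y\cdot z)+Q(x\cdot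 y\cdot z)=0$ for all $x,y,z$. Relative PCA coalgebra: $(A,\Delta,\theta,Q,P)$ with $(A,\Delta)$ cocommutative coassociative; $(A,\theta)$ an anti-pre-Lie coalgebra, i.e. $(\mathrm{id}^{\otimes 3}-\tau\otimes\mathrm{id})(\mathrm{id}\otimes\theta)\theta=(\tau\otimes\mathrm{id}-\mathrm{id}^{\otimes 3})(\theta\otimes\mathrm{id})\theta$ and $(\mathrm{id}^{\otimes 3}+\xi+\xi^{2})(\tau\otimes\mathrm{id}-\mathrm{id}^{\otimes 3})(\theta\otimes\mathrm{id})\theta=0$; $Q,P$ linear; and with $\delta=\theta-\tau\theta$, for all $x$: $\Delta Q=(Q\otimes\mathrm{id}+\mathrm{id}\otimes Q)\Delta$; $\delta Q=(Q\otimes\mathrm{id}+\mathrm{id}\otimes Q)\delta$; $(\mathrm{id}\otimes\Delta)\delta(x)-(\delta\otimes\mathrm{id})\Delta(x)-(\tau\otimes\mathrm{id})(\mathrm{id}\otimes\delta)\Delta(x)-(Q\otimes\mathrm{id}\otimes\mathrm{id})(\Delta\otimes\mathrm{id})\Delta(x)=0$; $\Delta P=(\mathrm{id}\otimes P-Q\otimes\mathrm{id})\Delta$; $\theta P=(\mathrm{id}\otimes P-Q\otimes\mathrm{id})\theta$; $(\mathrm{id}\otimes\theta)\Delta(x)-(\tau\otimes\mathrm{id})(\mathrm{id}\otimes\Delta)\theta(x)+(\delta\otimes\mathrm{id})\Delta(x)-(\mathrm{id}\otimes Q\otimes\mathrm{id})(\Delta\otimes\mathrm{id})\Delta(x)=0$;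 $(\Delta\otimes\mathrm{id})\theta(x)=(\tau\otimes\mathrm{id})(\mathrm{id}\otimes\Delta)\theta(x)+(\mathrm{id}\otimes\Delta)\theta(x)-(\Delta\otimes\mathrm{id})\Delta(P(x))$. Relative PCA bialgebra: $(A,\cdot,\circ,\Delta,\theta,P,Q)$ such that $(A,\cdot,\circ,P,Q)$ is a relative PCA algebra, $(A,\Delta,\theta,Q,P)$ is a relative PCA coalgebra, $(A,\cdot,\Delta)$ is a commutative and cocommutative ASI bialgebra, and for all $x,y\in A$ (with $[x,y]=x\circ y-y\circ x$, $\delta=\theta-\tau\theta$): (b) [anti-pre-Lie bialgebra] $(\mathrm{id}^{\otimes 2}-\tau)\big(\theta(x\circ y)-(\mathcal{L}_{\circ}(x)\otimes\mathrm{id})\theta(y)-(\mathrm{id}\otimes\mathcal{L}_{\circ}(x))\theta(y)+(\mathrm{id}\otimes\mathcal{R}_{\circ}(y))\theta(x)\big)=0$ and $\theta([x,y])=(\mathrm{id}\otimes\mathrm{ad}(x)-\mathcal{L}_{\circ}(x)\otimes\mathrm{id})\theta(y)-(\mathrm{id}\otimes\mathrm{ad}(y)-\mathcal{L}_{\circ}(y)\otimes\mathrm{id})\theta(x)$; (c) $\theta(x\cdot y)+(\mathcal{L}_{\circ}(y)\otimes\mathrm{id})\Delta(x)-(\mathrm{id}\otimes\mathcal{L}_{\cdot}(x))\theta(y)+(\mathcal{L}_{\circ}(x)\otimes\mathrm{id})\Delta(y)-(\mathrm{id}\otimes\mathcal{L}_{\cdot}(y))\theta(x)-(Q\otimes\mathrm{id})\Delta(x\cdot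 y)=0$; (d) $\Delta(x\circ y)+(\tau+\mathrm{id}^{\otimes 2})(\mathrm{id}\otimes\mathcal{L}_{\cdot}(y))\theta(x)-(\mathrm{id}\otimes\mathcal{L}_{\circ}(x)+\mathcal{L}_{\circ}(x)\otimes\mathrm{id})\Delta(y)-\Delta(P(x)\cdot y)=0$; (e) $(\mathcal{L}_{\cdot}(x)\otimes\mathrm{id}-\mathrm{id}\otimes\mathcal{L}_{\cdot}(x))\theta(y)+(\mathcal{L}_{\circ}(y)\otimes\mathrm{id}-\mathrm{id}\otimes\mathrm{ad}(y))\Delta(x)-\Delta([x,y])+\Delta(x\cdot P(y))=0$; (f) $(\mathrm{id}\otimes\mathcal{R}_{\circ}(y))\Delta(x)+(\mathcal{L}_{\cdot}(x)\otimes\mathrm{id})\delta(y)-(\mathrm{id}\otimes\mathcal{L}_{\circ}(x))\Delta(y)+\tau(\mathrm{id}\otimes\mathcal{L}_{\cdot}(y))\theta(x)-\delta(x\cdot y)+(\mathrm{id}\otimes Q)\Delta(x\cdot y)=0$. *)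

theory Defs
  imports
    "HOL-Computational_Algebra.Polynomial"
    "HOL-Analysis.Cartesian_Space"
begin

definition bilinear_map ::
  "('k::field \<Rightarrow> 'a::ab_group_add \<Rightarrow> 'a) \<Rightarrow> ('k \<Rightarrow> 'w::ab_group_add \<Rightarrow> 'w) \<Rightarrow> ('a \<Rightarrow> 'a \<Rightarrow> 'w) \<Rightarrow> bool"
  where "bilinear_map s sw \<beta> \<longleftrightarrow>
    (\<forall>y. Vector_Spaces.linear s sw (\<lambda>x. \<beta> x y)) \<and>
    (\<forall>x. Vector_Spaces.linear s sw (\<lambda>y. \<beta> x y))"

definition trilinear_map ::
  "('k::field \<Rightarrow> 'a::ab_group_add \<Rightarrow> 'a) \<Rightarrow> ('k \<Rightarrow> 'w::ab_group_add \<Rightarrow> 'w) \<Rightarrow> ('a \<Rightarrow> 'a \<Rightarrow> 'a \<Rightarrow> 'w) \<Rightarrow> bool"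
  where "trilinear_map s sw \<beta> \<longleftrightarrow>
    (\<forall>y z. Vector_Spaces.linear s sw (\<lambda>x. \<beta> x y z)) \<and>
    (\<forall>x z. Vector_Spaces.linear s sw (\<lambda>y. \<beta> x y z)) \<and>
    (\<forall>x y. Vector_Spaces.linear s sw (\<lambda>z. \<beta> x y z))"

lemma vector_space_linearI:
  assumes "vector_space s1" and "vector_space s2"
    and "\<And>x y. f (x + y) = f x + f y" and "\<And>c x. f (s1 c x) = s2 c (f x)"
  shows "Vector_Spaces.linear s1 s2 f"
  using assms
  by (simp add: Vector_Spaces.linear_def module_hom_def module_hom_axioms_def module_iff_vector_space)

lemma ex1_unique: "\<exists>!x. P x \<Longrightarrow> P a \<Longrightarrow> P b \<Longrightarrow> a = b"
  by blast

text \<open>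
  A finite-dimensional vector space \<open>A\<close> (type \<open>'a\<close>) together with tensor powers \<open>A \<otimes> A\<close> (type \<open>'t\<close>)
  and \<open>A \<otimes> A \<otimes> A\<close> (type \<open>'u\<close>), given by their universal properties; associativity of the tensor
  product is built in by taking the threefold power to be universal for trilinear maps.
  A locale assumption cannot quantify over the type of the target space, so
  the universal properties are postulated for multilinear forms only. This is no loss: the lemmas
  \<open>universal_bilinear\<close> and \<open>universal_trilinear\<close> derive them for an arbitrary target space.
\<close>

locale tensor_powers = finite_dimensional_vector_space scale Basis
  + sq: vector_space scale2 + cu: vector_space scale3
  for scale :: "'k::field \<Rightarrow> 'a::ab_group_add \<Rightarrow> 'a" and Basis :: "'a set"
    and scale2 :: "'k \<Rightarrow> 't::ab_group_add \<Rightarrow> 't"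
    and scale3 :: "'k \<Rightarrow> 'u::ab_group_add \<Rightarrow> 'u" +
  fixes tens2 :: "'a \<Rightarrow> 'a \<Rightarrow> 't"
    and tens3 :: "'a \<Rightarrow> 'a \<Rightarrow> 'a \<Rightarrow> 'u"
  assumes bilinear_tens2: "bilinear_map scale scale2 tens2"
    and trilinear_tens3: "trilinear_map scale scale3 tens3"
    and universal_bilinear_form: "bilinear_map scale (*) \<beta> \<Longrightarrow>
      \<exists>!h. Vector_Spaces.linear scale2 (*) h \<and> (\<forall>x y. h (tens2 x y) = \<beta> x y)"
    and universal_trilinear_form: "trilinear_map scale (*) \<gamma> \<Longrightarrow>
      \<exists>!h. Vector_Spaces.linear scale3 (*) h \<and> (\<forall>x y z. h (tens3 x y z) = \<gamma> x y z)"
begin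

lemma linear_zero_if_forms_vanish:
  assumes lin: "Vector_Spaces.linear st (sw :: 'k \<Rightarrow> 'w::ab_group_add \<Rightarrow> 'w) d"
    and forms: "\<And>f. Vector_Spaces.linear sw (*) f \<Longrightarrow> f \<circ> d = (\<lambda>_. 0 :: 'k)"
  shows "d t = 0"
proof (rule ccontr)
  assume nz: "d t \<noteq> 0"
  interpret d: Vector_Spaces.linear st sw d by (rule lin)
  interpret vs: vector_space_pair sw "(*) :: 'k \<Rightarrow> 'k \<Rightarrow> 'k"
    by (intro vector_space_pair.intro d.vs2.vector_space_axioms vector_space_over_itself.vector_space_axioms)
  have "d.vs2.independent {d t}"
    using nz by (simp add: d.vs2.dependent_single)
  then obtain f where "Vector_Spaces.linear sw (*) f" "f (d t) = (1 :: 'k)"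
    using vs.linear_independent_extend[of "{d t}" "\<lambda>_. 1"] by auto
  with forms[of f] show False
    by (auto simp: fun_eq_iff)
qed

lemma linear_coordinate: "Vector_Spaces.linear scale (*) (\<lambda>x. representation Basis x b)"
  by (rule vector_space_linearI[OF vector_space_axioms vector_space_over_itself.vector_space_axioms])
    (simp_all add: representation_add representation_scale independent_Basis span_Basis)

lemma linear_sum_coordinates:
  assumes "Vector_Spaces.linear scale sw f"
  shows "f x = (\<Sum>b\<in>Basis. sw (representation Basis x b) (f b))"
proof -
  interpret f: Vector_Spaces.linear scale sw f by fact
  have "x = (\<Sum>b\<in>Basis. scale (representation Basis x b) b)"
    by (rule sum_representation_eq[symmetric]) (simp_all add: independent_Basis span_Basis finite_Basis)
  then have "f x = f (\<Sum>b\<in>Basis. scale (representation Basis x b) b)" by simp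
  then show ?thesis by (simp add: f.sum f.scale)
qed

lemma linear_weighted_sum:
  assumes "vector_space sw" and "\<And>i. i \<in> I \<Longrightarrow> Vector_Spaces.linear st (*) (\<phi> i)"
    and "vector_space st"
  shows "Vector_Spaces.linear st sw (\<lambda>t. \<Sum>i\<in>I. sw (\<phi> i t) (w i))"
proof -
  interpret w: vector_space sw by fact
  show ?thesis
  proof (rule vector_space_linearI[OF assms(3,1)])
    fix x y
    have "sw (\<phi> i (x + y)) (w i) = sw (\<phi> i x) (w i) + sw (\<phi> i y) (w i)" if "i \<in> I" for i
    proof -
      interpret l: Vector_Spaces.linear st "(*)" "\<phi> i" using assms(2) that .
      show ?thesis by (simp add: l.add w.scale_left_distrib)
    qed
    then show "(\<Sum>i\<in>I. sw (\<phi> i (x + y)) (w i)) = (\<Sum>i\<in>I. sw (\<phi> i x) (w i)) + (\<Sum>i\<in>I. sw (\<phi> i y) (w i))"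
      by (simp add: sum.distrib)
  next
    fix c x
    have "sw (\<phi> i (st c x)) (w i) = sw c (sw (\<phi> i x) (w i))" if "i \<in> I" for i
    proof -
      interpret l: Vector_Spaces.linear st "(*)" "\<phi> i" using assms(2) that .
      show ?thesis by (simp only: l.scale w.scale_scale)
    qed
    then show "(\<Sum>i\<in>I. sw (\<phi> i (st c x)) (w i)) = sw c (\<Sum>i\<in>I. sw (\<phi> i x) (w i))"
      unfolding w.scale_sum_right by (intro sum.cong refl)
  qed
qed

lemma linear_diff_maps:
  assumes "Vector_Spaces.linear st sw g" and "Vector_Spaces.linear st sw h"
  shows "Vector_Spaces.linear st sw (\<lambda>t. g t - h t)"
proof -
  interpret g: Vector_Spaces.linear st sw g by fact
  interpret vector_space_pair st sw
    by (intro vector_space_pair.intro g.vs1.vector_space_axioms g.vs2.vector_space_axioms)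
  show ?thesis using assms by (rule linear_compose_sub)
qed

lemma linear_zero_map:
  assumes "vector_space st"
  shows "Vector_Spaces.linear st (*) (\<lambda>_. 0 :: 'k)"
proof -
  interpret vector_space_pair st "(*) :: 'k \<Rightarrow> 'k \<Rightarrow> 'k"
    by (intro vector_space_pair.intro assms vector_space_over_itself.vector_space_axioms)
  show ?thesis by (rule linear_zero)
qed

lemma linear_scale_form:
  assumes "Vector_Spaces.linear st (*) f"
  shows "Vector_Spaces.linear st (*) (\<lambda>x. c * f x :: 'k)"
    and "Vector_Spaces.linear st (*) (\<lambda>x. f x * c :: 'k)"
proof -
  interpret f: Vector_Spaces.linear st "(*)" f by fact
  show "Vector_Spaces.linear st (*) (\<lambda>x. c * f x)"
    by (rule vector_space_linearI[OF f.vs1.vector_space_axioms vector_space_over_itself.vector_space_axioms])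
      (simp_all add: f.add f.scale algebra_simps)
  then show "Vector_Spaces.linear st (*) (\<lambda>x. f x * c)"
    by (simp add: mult.commute)
qed

lemma universal_bilinear:
  assumes \<beta>: "bilinear_map scale sw (\<beta> :: 'a \<Rightarrow> 'a \<Rightarrow> 'w::ab_group_add)"
  shows "\<exists>!h. Vector_Spaces.linear scale2 sw h \<and> (\<forall>x y. h (tens2 x y) = \<beta> x y)"
proof (rule ex_ex1I)
  let ?r = "representation Basis"
  have vw: "vector_space sw"
    using \<beta> by (auto simp: bilinear_map_def Vector_Spaces.linear_def)
  interpret w: vector_space sw by (rule vw)
  have "\<exists>h. Vector_Spaces.linear scale2 (*) h \<and> (\<forall>x y. h (tens2 x y) = ?r x (fst i) * ?r y (snd i))" for i
    by (rule ex1_implies_ex[OF universal_bilinear_form])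
      (auto simp: bilinear_map_def intro!: linear_scale_form linear_coordinate)
  then obtain \<phi> where \<phi>: "\<And>i. Vector_Spaces.linear scale2 (*) (\<phi> i)"
    "\<And>i x y. \<phi> i (tens2 x y) = ?r x (fst i) * ?r y (snd i)"
    by metis
  let ?h = "\<lambda>t. \<Sum>i\<in>Basis \<times> Basis. sw (\<phi> i t) (\<beta> (fst i) (snd i))"
  have "?h (tens2 x y) = \<beta> x y" for x y
  proof -
    have "\<beta> x y = (\<Sum>b\<in>Basis. sw (?r x b) (\<beta> b y))"
      using \<beta> by (intro linear_sum_coordinates) (auto simp: bilinear_map_def)
    also have "\<dots> = (\<Sum>b\<in>Basis. sw (?r x b) (\<Sum>c\<in>Basis. sw (?r y c) (\<beta> b c)))"
      using \<beta> by (intro sum.cong refl arg_cong[where f = "sw _"] linear_sum_coordinates)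
        (auto simp: bilinear_map_def)
    also have "\<dots> = ?h (tens2 x y)"
      by (simp add: \<phi> sum.cartesian_product' w.scale_sum_right)
    finally show ?thesis by simp
  qed
  moreover have "Vector_Spaces.linear scale2 sw ?h"
    by (intro linear_weighted_sum vw \<phi> sq.vector_space_axioms)
  ultimately show "\<exists>h. Vector_Spaces.linear scale2 sw h \<and> (\<forall>x y. h (tens2 x y) = \<beta> x y)"
    by blast
next
  fix g h
  assume g: "Vector_Spaces.linear scale2 sw g \<and> (\<forall>x y. g (tens2 x y) = \<beta> x y)"
    and h: "Vector_Spaces.linear scale2 sw h \<and> (\<forall>x y. h (tens2 x y) = \<beta> x y)"
  have d: "Vector_Spaces.linear scale2 sw (\<lambda>t. g t - h t)"
    using g h by (intro linear_diff_maps) auto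
  have z: "Vector_Spaces.linear scale (*) (\<lambda>_. 0 :: 'k)" "Vector_Spaces.linear scale2 (*) (\<lambda>_. 0 :: 'k)"
    by (intro linear_zero_map vector_space_axioms sq.vector_space_axioms)+
  have "f \<circ> (\<lambda>t. g t - h t) = (\<lambda>_. 0)" if f: "Vector_Spaces.linear sw (*) f" for f :: "'w \<Rightarrow> 'k"
  proof -
    interpret f: Vector_Spaces.linear sw "(*)" f by (rule f)
    have "Vector_Spaces.linear scale2 (*) (f \<circ> (\<lambda>t. g t - h t))"
      using d f by (rule Vector_Spaces.linear_compose)
    moreover have "(f \<circ> (\<lambda>t. g t - h t)) (tens2 x y) = 0" for x y
      using g h by (simp add: f.zero)
    moreover have "bilinear_map scale (*) (\<lambda>_ _. 0 :: 'k)"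
      using z by (simp add: bilinear_map_def)
    ultimately show ?thesis
      using z by (intro ex1_unique[OF universal_bilinear_form[of "\<lambda>_ _. 0"]]) simp_all
  qed
  then have "g t - h t = 0" for t
    by (rule linear_zero_if_forms_vanish[OF d])
  then show "g = h" by (auto simp: fun_eq_iff)
qed

lemma universal_trilinear:
  assumes \<gamma>: "trilinear_map scale sw (\<gamma> :: 'a \<Rightarrow> 'a \<Rightarrow> 'a \<Rightarrow> 'w::ab_group_add)"
  shows "\<exists>!h. Vector_Spaces.linear scale3 sw h \<and> (\<forall>x y z. h (tens3 x y z) = \<gamma> x y z)"
proof (rule ex_ex1I)
  let ?r = "representation Basis"
  have vw: "vector_space sw"
    using \<gamma> by (auto simp: trilinear_map_def Vector_Spaces.linear_def)
  interpret w: vector_space sw by (rule vw)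
  have "\<exists>h. Vector_Spaces.linear scale3 (*) h \<and>
      (\<forall>x y z. h (tens3 x y z) = ?r x (fst i) * (?r y (fst (snd i)) * ?r z (snd (snd i))))" for i
    by (rule ex1_implies_ex[OF universal_trilinear_form])
      (auto simp: trilinear_map_def intro!: linear_scale_form linear_coordinate)
  then obtain \<phi> where \<phi>: "\<And>i. Vector_Spaces.linear scale3 (*) (\<phi> i)"
    "\<And>i x y z. \<phi> i (tens3 x y z) = ?r x (fst i) * (?r y (fst (snd i)) * ?r z (snd (snd i)))"
    by metis
  let ?h = "\<lambda>t. \<Sum>i\<in>Basis \<times> Basis \<times> Basis. sw (\<phi> i t) (\<gamma> (fst i) (fst (snd i)) (snd (snd i)))"
  have "?h (tens3 x y z) = \<gamma> x y z" for x y z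
  proof -
    have "\<gamma> x y z = (\<Sum>b\<in>Basis. sw (?r x b) (\<gamma> b y z))"
      using \<gamma> by (intro linear_sum_coordinates) (auto simp: trilinear_map_def)
    also have "\<dots> = (\<Sum>b\<in>Basis. sw (?r x b) (\<Sum>c\<in>Basis. sw (?r y c) (\<gamma> b c z)))"
      using \<gamma> by (intro sum.cong refl arg_cong[where f = "sw _"] linear_sum_coordinates)
        (auto simp: trilinear_map_def)
    also have "\<dots> = (\<Sum>b\<in>Basis. sw (?r x b) (\<Sum>c\<in>Basis. sw (?r y c)
        (\<Sum>d\<in>Basis. sw (?r z d) (\<gamma> b c d))))"
      using \<gamma> by (intro sum.cong refl arg_cong[where f = "sw _"] linear_sum_coordinates)
        (auto simp: trilinear_map_def)
    also have "\<dots> = ?h (tens3 x y z)"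
      by (simp add: \<phi> sum.cartesian_product' w.scale_sum_right)
    finally show ?thesis by simp
  qed
  moreover have "Vector_Spaces.linear scale3 sw ?h"
    by (intro linear_weighted_sum vw \<phi> cu.vector_space_axioms)
  ultimately show "\<exists>h. Vector_Spaces.linear scale3 sw h \<and> (\<forall>x y z. h (tens3 x y z) = \<gamma> x y z)"
    by blast
next
  fix g h
  assume g: "Vector_Spaces.linear scale3 sw g \<and> (\<forall>x y z. g (tens3 x y z) = \<gamma> x y z)"
    and h: "Vector_Spaces.linear scale3 sw h \<and> (\<forall>x y z. h (tens3 x y z) = \<gamma> x y z)"
  have d: "Vector_Spaces.linear scale3 sw (\<lambda>t. g t - h t)"
    using g h by (intro linear_diff_maps) auto
  have z: "Vector_Spaces.linear scale (*) (\<lambda>_. 0 :: 'k)" "Vector_Spaces.linear scale3 (*) (\<lambda>_. 0 :: 'k)"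
    by (intro linear_zero_map vector_space_axioms cu.vector_space_axioms)+
  have "f \<circ> (\<lambda>t. g t - h t) = (\<lambda>_. 0)" if f: "Vector_Spaces.linear sw (*) f" for f :: "'w \<Rightarrow> 'k"
  proof -
    interpret f: Vector_Spaces.linear sw "(*)" f by (rule f)
    have "Vector_Spaces.linear scale3 (*) (f \<circ> (\<lambda>t. g t - h t))"
      using d f by (rule Vector_Spaces.linear_compose)
    moreover have "(f \<circ> (\<lambda>t. g t - h t)) (tens3 x y z) = 0" for x y z
      using g h by (simp add: f.zero)
    moreover have "trilinear_map scale (*) (\<lambda>_ _ _. 0 :: 'k)"
      using z by (simp add: trilinear_map_def)
    ultimately show ?thesis
      using z by (intro ex1_unique[OF universal_trilinear_form[of "\<lambda>_ _ _. 0"]]) simp_all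
  qed
  then have "g t - h t = 0" for t
    by (rule linear_zero_if_forms_vanish[OF d])
  then show "g = h" by (auto simp: fun_eq_iff)
qed

definition lift2 :: "('k \<Rightarrow> 'w::ab_group_add \<Rightarrow> 'w) \<Rightarrow> ('a \<Rightarrow> 'a \<Rightarrow> 'w) \<Rightarrow> 't \<Rightarrow> 'w"
  where "lift2 sw \<beta> = (THE h. Vector_Spaces.linear scale2 sw h \<and> (\<forall>x y. h (tens2 x y) = \<beta> x y))"

definition lift3 :: "('k \<Rightarrow> 'w::ab_group_add \<Rightarrow> 'w) \<Rightarrow> ('a \<Rightarrow> 'a \<Rightarrow> 'a \<Rightarrow> 'w) \<Rightarrow> 'u \<Rightarrow> 'w"
  where "lift3 sw \<gamma> = (THE h. Vector_Spaces.linear scale3 sw h \<and> (\<forall>x y z. h (tens3 x y z) = \<gamma> x y z))"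

text \<open>
  Induced maps:
  \<open>tau\<close> is \<open>\<tau>\<close>, \<open>xi\<close> is \<open>\<xi>\<close>, \<open>tau_id\<close> is \<open>\<tau> \<otimes> id\<close>, \<open>map2 f g\<close> is \<open>f \<otimes> g\<close> on \<open>A \<otimes> A\<close> and
  \<open>map3 f g h\<close> is \<open>f \<otimes> g \<otimes> h\<close> on \<open>A \<otimes> A \<otimes> A\<close> for linear endomorphisms of \<open>A\<close>.
  For linear \<open>F : A \<rightarrow> A \<otimes> A\<close>, \<open>id_ten F\<close> is \<open>id \<otimes> F\<close> and \<open>ten_id F\<close> is \<open>F \<otimes> id\<close>, both
  with values in \<open>A \<otimes> A \<otimes> A\<close>; the inner lift is \<open>b \<otimes> c \<mapsto> x \<otimes> b \<otimes> c\<close>, respectively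
  \<open>a \<otimes> b \<mapsto> a \<otimes> b \<otimes> y\<close>.
\<close>

definition tau :: "'t \<Rightarrow> 't"
  where "tau = lift2 scale2 (\<lambda>x y. tens2 y x)"

definition map2 :: "('a \<Rightarrow> 'a) \<Rightarrow> ('a \<Rightarrow> 'a) \<Rightarrow> 't \<Rightarrow> 't"
  where "map2 f g = lift2 scale2 (\<lambda>x y. tens2 (f x) (g y))"

definition xi :: "'u \<Rightarrow> 'u"
  where "xi = lift3 scale3 (\<lambda>x y z. tens3 y z x)"

definition tau_id :: "'u \<Rightarrow> 'u"
  where "tau_id = lift3 scale3 (\<lambda>x y z. tens3 y x z)"

definition map3 :: "('a \<Rightarrow> 'a) \<Rightarrow> ('a \<Rightarrow> 'a) \<Rightarrow> ('a \<Rightarrow> 'a) \<Rightarrow> 'u \<Rightarrow> 'u"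
  where "map3 f g h = lift3 scale3 (\<lambda>x y z. tens3 (f x) (g y) (h z))"

definition id_ten :: "('a \<Rightarrow> 't) \<Rightarrow> 't \<Rightarrow> 'u"
  where "id_ten F = lift2 scale3 (\<lambda>x y. lift2 scale3 (\<lambda>b c. tens3 x b c) (F y))"

definition ten_id :: "('a \<Rightarrow> 't) \<Rightarrow> 't \<Rightarrow> 'u"
  where "ten_id F = lift2 scale3 (\<lambda>x y. lift2 scale3 (\<lambda>a b. tens3 a b y) (F x))"

definition delta_of :: "('a \<Rightarrow> 't) \<Rightarrow> 'a \<Rightarrow> 't"
  where "delta_of \<theta> x = \<theta> x - tau (\<theta> x)"

definition commutator :: "('a \<Rightarrow> 'a \<Rightarrow> 'a) \<Rightarrow> 'a \<Rightarrow> 'a \<Rightarrow> 'a"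
  where "commutator circ x y = circ x y - circ y x"

definition linear_endo :: "('a \<Rightarrow> 'a) \<Rightarrow> bool"
  where "linear_endo P \<longleftrightarrow> Vector_Spaces.linear scale scale P"

definition linear_comult :: "('a \<Rightarrow> 't) \<Rightarrow> bool"
  where "linear_comult \<Delta> \<longleftrightarrow> Vector_Spaces.linear scale scale2 \<Delta>"

definition comm_assoc_algebra :: "('a \<Rightarrow> 'a \<Rightarrow> 'a) \<Rightarrow> bool"
  where "comm_assoc_algebra mul \<longleftrightarrow>
    bilinear_map scale scale mul \<and>
    (\<forall>x y. mul x y = mul y x) \<and>
    (\<forall>x y z. mul (mul x y) z = mul x (mul y z))"

definition lie_algebra :: "('a \<Rightarrow> 'a \<Rightarrow> 'a) \<Rightarrow> bool"
  where "lie_algebra br \<longleftrightarrow>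
    bilinear_map scale scale br \<and>
    (\<forall>x. br x x = 0) \<and>
    (\<forall>x y z. br x (br y z) + br y (br z x) + br z (br x y) = 0)"

definition derivation :: "('a \<Rightarrow> 'a \<Rightarrow> 'a) \<Rightarrow> ('a \<Rightarrow> 'a) \<Rightarrow> bool"
  where "derivation mul P \<longleftrightarrow>
    linear_endo P \<and> (\<forall>x y. P (mul x y) = mul (P x) y + mul x (P y))"

definition cocomm_coassoc_coalgebra :: "('a \<Rightarrow> 't) \<Rightarrow> bool"
  where "cocomm_coassoc_coalgebra \<Delta> \<longleftrightarrow>
    linear_comult \<Delta> \<and>
    (\<forall>x. tau (\<Delta> x) = \<Delta> x) \<and>
    (\<forall>x. id_ten \<Delta> (\<Delta> x) = ten_id \<Delta> (\<Delta> x))"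

definition comm_cocomm_ASI_bialgebra :: "('a \<Rightarrow> 'a \<Rightarrow> 'a) \<Rightarrow> ('a \<Rightarrow> 't) \<Rightarrow> bool"
  where "comm_cocomm_ASI_bialgebra mul \<Delta> \<longleftrightarrow>
    comm_assoc_algebra mul \<and>
    cocomm_coassoc_coalgebra \<Delta> \<and>
    (\<forall>x y. \<Delta> (mul x y) = map2 (mul x) id (\<Delta> y) + map2 id (mul y) (\<Delta> x))"

definition admissible_comm_diff_algebra ::
  "('a \<Rightarrow> 'a \<Rightarrow> 'a) \<Rightarrow> ('a \<Rightarrow> 'a) \<Rightarrow> ('a \<Rightarrow> 'a) \<Rightarrow> bool"
  where "admissible_comm_diff_algebra mul P Q \<longleftrightarrow>
    comm_assoc_algebra mul \<and> derivation mul P \<and> linear_endo Q \<and>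
    (\<forall>x y. mul x (Q y) - mul (P x) y - Q (mul x y) = 0)"

definition admissible_cocomm_diff_coalgebra ::
  "('a \<Rightarrow> 't) \<Rightarrow> ('a \<Rightarrow> 'a) \<Rightarrow> ('a \<Rightarrow> 'a) \<Rightarrow> bool"
  where "admissible_cocomm_diff_coalgebra \<Delta> Q P \<longleftrightarrow>
    cocomm_coassoc_coalgebra \<Delta> \<and> linear_endo Q \<and> linear_endo P \<and>
    (\<forall>x. \<Delta> (Q x) = map2 Q id (\<Delta> x) + map2 id Q (\<Delta> x)) \<and>
    (\<forall>x. \<Delta> (P x) = map2 id P (\<Delta> x) - map2 Q id (\<Delta> x))"

definition comm_cocomm_diff_ASI_bialgebra ::
  "('a \<Rightarrow> 'a \<Rightarrow> 'a) \<Rightarrow> ('a \<Rightarrow> 't) \<Rightarrow> ('a \<Rightarrow> 'a) \<Rightarrow> ('a \<Rightarrow> 'a) \<Rightarrow> bool"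
  where "comm_cocomm_diff_ASI_bialgebra mul \<Delta> P Q \<longleftrightarrow>
    comm_cocomm_ASI_bialgebra mul \<Delta> \<and>
    admissible_comm_diff_algebra mul P Q \<and>
    admissible_cocomm_diff_coalgebra \<Delta> Q P"

definition relative_Poisson_algebra ::
  "('a \<Rightarrow> 'a \<Rightarrow> 'a) \<Rightarrow> ('a \<Rightarrow> 'a \<Rightarrow> 'a) \<Rightarrow> ('a \<Rightarrow> 'a) \<Rightarrow> bool"
  where "relative_Poisson_algebra mul br P \<longleftrightarrow>
    comm_assoc_algebra mul \<and> lie_algebra br \<and>
    derivation mul P \<and> derivation br P \<and>
    (\<forall>x y z. br z (mul x y) = mul (br z x) y + mul x (br z y) + mul (mul x y) (P z))"

definition anti_pre_Lie_algebra :: "('a \<Rightarrow> 'a \<Rightarrow> 'a) \<Rightarrow> bool"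
  where "anti_pre_Lie_algebra circ \<longleftrightarrow>
    bilinear_map scale scale circ \<and>
    (\<forall>x y z. circ x (circ y z) - circ y (circ x z) = circ (commutator circ y x) z) \<and>
    (\<forall>x y z. circ (commutator circ x y) z + circ (commutator circ y z) x
      + circ (commutator circ z x) y = 0)"

definition relative_PCA_algebra ::
  "('a \<Rightarrow> 'a \<Rightarrow> 'a) \<Rightarrow> ('a \<Rightarrow> 'a \<Rightarrow> 'a) \<Rightarrow> ('a \<Rightarrow> 'a) \<Rightarrow> ('a \<Rightarrow> 'a) \<Rightarrow> bool"
  where "relative_PCA_algebra mul circ P Q \<longleftrightarrow>
    comm_assoc_algebra mul \<and> anti_pre_Lie_algebra circ \<and> linear_endo P \<and> linear_endo Q \<and>
    relative_Poisson_algebra mul (commutator circ) P \<and>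
    (\<forall>x y. mul x (Q y) - mul (P x) y - Q (mul x y) = 0) \<and>
    (\<forall>x y. circ x (Q y) - circ (P x) y - Q (circ x y) = 0) \<and>
    (\<forall>x y z. mul x (circ y z) - circ y (mul x z) + mul (commutator circ x y) z
      - mul (mul x (P y)) z = 0) \<and>
    (\<forall>x y z. circ (mul x y) z - circ y (mul x z) - circ x (mul y z) + Q (mul (mul x y) z) = 0)"

definition anti_pre_Lie_coalgebra :: "('a \<Rightarrow> 't) \<Rightarrow> bool"
  where "anti_pre_Lie_coalgebra \<theta> \<longleftrightarrow>
    linear_comult \<theta> \<and>
    (\<forall>x. id_ten \<theta> (\<theta> x) - tau_id (id_ten \<theta> (\<theta> x))
      = tau_id (ten_id \<theta> (\<theta> x)) - ten_id \<theta> (\<theta> x)) \<and>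
    (\<forall>x. let w = tau_id (ten_id \<theta> (\<theta> x)) - ten_id \<theta> (\<theta> x) in w + xi w + xi (xi w) = 0)"

definition relative_PCA_coalgebra ::
  "('a \<Rightarrow> 't) \<Rightarrow> ('a \<Rightarrow> 't) \<Rightarrow> ('a \<Rightarrow> 'a) \<Rightarrow> ('a \<Rightarrow> 'a) \<Rightarrow> bool"
  where "relative_PCA_coalgebra \<Delta> \<theta> Q P \<longleftrightarrow> (let \<delta> = delta_of \<theta> in
    cocomm_coassoc_coalgebra \<Delta> \<and> anti_pre_Lie_coalgebra \<theta> \<and> linear_endo Q \<and> linear_endo P \<and>
    (\<forall>x. \<Delta> (Q x) = map2 Q id (\<Delta> x) + map2 id Q (\<Delta> x)) \<and>
    (\<forall>x. \<delta> (Q x) = map2 Q id (\<delta> x) + map2 id Q (\<delta> x)) \<and>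
    (\<forall>x. id_ten \<Delta> (\<delta> x) - ten_id \<delta> (\<Delta> x) - tau_id (id_ten \<delta> (\<Delta> x))
      - map3 Q id id (ten_id \<Delta> (\<Delta> x)) = 0) \<and>
    (\<forall>x. \<Delta> (P x) = map2 id P (\<Delta> x) - map2 Q id (\<Delta> x)) \<and>
    (\<forall>x. \<theta> (P x) = map2 id P (\<theta> x) - map2 Q id (\<theta> x)) \<and>
    (\<forall>x. id_ten \<theta> (\<Delta> x) - tau_id (id_ten \<Delta> (\<theta> x)) + ten_id \<delta> (\<Delta> x)
      - map3 id Q id (ten_id \<Delta> (\<Delta> x)) = 0) \<and>
    (\<forall>x. ten_id \<Delta> (\<theta> x) = tau_id (id_ten \<Delta> (\<theta> x)) + id_ten \<Delta> (\<theta> x)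
      - ten_id \<Delta> (\<Delta> (P x))))"

text \<open>
  \<open>circ x\<close> is \<open>\<L>\<^sub>\<circ>(x)\<close>, \<open>\<lambda>z. circ z y\<close> is \<open>\<R>\<^sub>\<circ>(y)\<close> and \<open>commutator circ x\<close> is \<open>ad(x)\<close>.
\<close>

definition anti_pre_Lie_compatible :: "('a \<Rightarrow> 'a \<Rightarrow> 'a) \<Rightarrow> ('a \<Rightarrow> 't) \<Rightarrow> bool"
  where "anti_pre_Lie_compatible circ \<theta> \<longleftrightarrow>
    (\<forall>x y. let w = \<theta> (circ x y) - map2 (circ x) id (\<theta> y) - map2 id (circ x) (\<theta> y)
        + map2 id (\<lambda>z. circ z y) (\<theta> x)
      in w - tau w = 0) \<and>
    (\<forall>x y. \<theta> (commutator circ x y)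
      = (map2 id (commutator circ x) (\<theta> y) - map2 (circ x) id (\<theta> y))
      - (map2 id (commutator circ y) (\<theta> x) - map2 (circ y) id (\<theta> x)))"

definition relative_PCA_bialgebra ::
  "('a \<Rightarrow> 'a \<Rightarrow> 'a) \<Rightarrow> ('a \<Rightarrow> 'a \<Rightarrow> 'a) \<Rightarrow> ('a \<Rightarrow> 't) \<Rightarrow> ('a \<Rightarrow> 't) \<Rightarrow> ('a \<Rightarrow> 'a) \<Rightarrow> ('a \<Rightarrow> 'a) \<Rightarrow> bool"
  where "relative_PCA_bialgebra mul circ \<Delta> \<theta> P Q \<longleftrightarrow> (let \<delta> = delta_of \<theta> in
    relative_PCA_algebra mul circ P Q \<and>
    relative_PCA_coalgebra \<Delta> \<theta> Q P \<and>
    comm_cocomm_ASI_bialgebra mul \<Delta> \<and>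
    anti_pre_Lie_compatible circ \<theta> \<and>
    (\<forall>x y. \<theta> (mul x y) + map2 (circ y) id (\<Delta> x) - map2 id (mul x) (\<theta> y)
      + map2 (circ x) id (\<Delta> y) - map2 id (mul y) (\<theta> x) - map2 Q id (\<Delta> (mul x y)) = 0) \<and>
    (\<forall>x y. \<Delta> (circ x y) + (tau (map2 id (mul y) (\<theta> x)) + map2 id (mul y) (\<theta> x))
      - (map2 id (circ x) (\<Delta> y) + map2 (circ x) id (\<Delta> y)) - \<Delta> (mul (P x) y) = 0) \<and>
    (\<forall>x y. (map2 (mul x) id (\<theta> y) - map2 id (mul x) (\<theta> y))
      + (map2 (circ y) id (\<Delta> x) - map2 id (commutator circ y) (\<Delta> x))
      - \<Delta> (commutator circ x y) + \<Delta> (mul x (P y)) = 0) \<and>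
    (\<forall>x y. map2 id (\<lambda>z. circ z y) (\<Delta> x) + map2 (mul x) id (\<delta> y) - map2 id (circ x) (\<Delta> y)
      + tau (map2 id (mul y) (\<theta> x)) - \<delta> (mul x y) + map2 id Q (\<Delta> (mul x y)) = 0))"

end

text \<open>
  The locale is satisfiable: a model over \<open>K\<^sup>n\<close> is given by the coordinate spaces indexed by pairs
  and triples, with the Kronecker products of coordinate vectors as pure tensors.
\<close>

lemma linear_vec_coordinates:
  fixes f :: "'k::field ^ 'n \<Rightarrow> 'w::ab_group_add"
  assumes "Vector_Spaces.linear (*s) sw f"
  shows "f x = (\<Sum>i\<in>UNIV. sw (x $ i) (f (axis i 1)))"
proof -
  interpret f: Vector_Spaces.linear "(*s)" sw f by fact
  have "f x = f (\<Sum>i\<in>UNIV. x $ i *s axis i 1)"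
    by (simp add: basis_expansion)
  then show ?thesis by (simp add: f.sum f.scale)
qed

lemma linear_vec_weighted_sum:
  "Vector_Spaces.linear (*s) (*) (\<lambda>x :: 'k::field ^ 'n. \<Sum>i\<in>UNIV. x $ i * w i)"
  by (rule vector_space_linearI[OF vec.vector_space_axioms vector_space_over_itself.vector_space_axioms])
    (simp_all add: algebra_simps sum.distrib sum_distrib_left)

lemma linear_vec_lambda:
  fixes g :: "'k::field ^ 'n \<Rightarrow> 'i::finite \<Rightarrow> 'k"
  assumes "\<And>x y i. g (x + y) i = g x i + g y i" and "\<And>c x i. g (c *s x) i = c * g x i"
  shows "Vector_Spaces.linear (*s) (*s) (\<lambda>x. \<chi> i. g x i)"
  by (rule vector_space_linearI[OF vec.vector_space_axioms vec.vector_space_axioms])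
    (simp_all add: vec_eq_iff assms)

lemma tensor_powers_vec:
  "tensor_powers (*s) cart_basis (*s) (*s)
    (\<lambda>(x :: 'k::field ^ 'n) (y :: 'k ^ 'n). (\<chi> i. x $ fst i * y $ snd i) :: 'k ^ ('n \<times> 'n))
    (\<lambda>x y z. (\<chi> i. x $ fst i * y $ fst (snd i) * z $ snd (snd i)) :: 'k ^ ('n \<times> 'n \<times> 'n))"
    (is "tensor_powers _ _ _ _ ?t2 ?t3")
proof unfold_locales
  show "bilinear_map (*s) (*s) ?t2"
    by (auto simp: bilinear_map_def algebra_simps intro!: linear_vec_lambda)
  show "trilinear_map (*s) (*s) ?t3"
    by (auto simp: trilinear_map_def algebra_simps intro!: linear_vec_lambda)
next
  fix \<beta> :: "'k ^ 'n \<Rightarrow> 'k ^ 'n \<Rightarrow> 'k"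
  assume \<beta>: "bilinear_map (*s) (*) \<beta>"
  have axis2: "?t2 (axis i 1) (axis j 1) = axis (i, j) 1" for i j
    by (auto simp: vec_eq_iff axis_def)
  let ?h = "\<lambda>t :: 'k ^ ('n \<times> 'n). \<Sum>i\<in>UNIV. t $ i * \<beta> (axis (fst i) 1) (axis (snd i) 1)"
  show "\<exists>!h. Vector_Spaces.linear (*s) (*) h \<and> (\<forall>x y. h (?t2 x y) = \<beta> x y)"
  proof (rule ex1I[of _ ?h], intro conjI allI)
    fix x y
    have "\<beta> x y = (\<Sum>i\<in>UNIV. x $ i * \<beta> (axis i 1) y)"
      using \<beta> by (intro linear_vec_coordinates) (auto simp: bilinear_map_def)
    also have "\<dots> = (\<Sum>i\<in>UNIV. x $ i * (\<Sum>j\<in>UNIV. y $ j * \<beta> (axis i 1) (axis j 1)))"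
      using \<beta> by (intro sum.cong refl arg_cong[where f = "(*) _"] linear_vec_coordinates)
        (auto simp: bilinear_map_def)
    also have "\<dots> = ?h (?t2 x y)"
      by (simp add: UNIV_Times_UNIV[symmetric] sum.cartesian_product' sum_distrib_left mult.assoc
          del: UNIV_Times_UNIV)
    finally show "?h (?t2 x y) = \<beta> x y" by simp
  next
    fix h
    assume h: "Vector_Spaces.linear (*s) (*) h \<and> (\<forall>x y. h (?t2 x y) = \<beta> x y)"
    have "h (axis (a, b) 1) = \<beta> (axis a 1) (axis b 1)" for a b
      unfolding axis2[symmetric] using h by blast
    then have ax: "h (axis i 1) = \<beta> (axis (fst i) 1) (axis (snd i) 1)" for i
      by (cases i) simp
    show "h = ?h"
    proof
      fix t show "h t = ?h t"
        using linear_vec_coordinates[of "(*)" h t] h by (simp add: ax)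
    qed
  qed (rule linear_vec_weighted_sum)
next
  fix \<gamma> :: "'k ^ 'n \<Rightarrow> 'k ^ 'n \<Rightarrow> 'k ^ 'n \<Rightarrow> 'k"
  assume \<gamma>: "trilinear_map (*s) (*) \<gamma>"
  have axis3: "?t3 (axis i 1) (axis j 1) (axis k 1) = axis (i, j, k) 1" for i j k
    by (auto simp: vec_eq_iff axis_def)
  let ?h = "\<lambda>t :: 'k ^ ('n \<times> 'n \<times> 'n). \<Sum>i\<in>UNIV. t $ i *
    \<gamma> (axis (fst i) 1) (axis (fst (snd i)) 1) (axis (snd (snd i)) 1)"
  show "\<exists>!h. Vector_Spaces.linear (*s) (*) h \<and> (\<forall>x y z. h (?t3 x y z) = \<gamma> x y z)"
  proof (rule ex1I[of _ ?h], intro conjI allI)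
    fix x y z
    have "\<gamma> x y z = (\<Sum>i\<in>UNIV. x $ i * \<gamma> (axis i 1) y z)"
      using \<gamma> by (intro linear_vec_coordinates) (auto simp: trilinear_map_def)
    also have "\<dots> = (\<Sum>i\<in>UNIV. x $ i * (\<Sum>j\<in>UNIV. y $ j * \<gamma> (axis i 1) (axis j 1) z))"
      using \<gamma> by (intro sum.cong refl arg_cong[where f = "(*) _"] linear_vec_coordinates)
        (auto simp: trilinear_map_def)
    also have "\<dots> = (\<Sum>i\<in>UNIV. x $ i * (\<Sum>j\<in>UNIV. y $ j *
        (\<Sum>k\<in>UNIV. z $ k * \<gamma> (axis i 1) (axis j 1) (axis k 1))))"
      using \<gamma> by (intro sum.cong refl arg_cong[where f = "(*) _"] linear_vec_coordinates)
        (auto simp: trilinear_map_def)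
    also have "\<dots> = ?h (?t3 x y z)"
      by (simp add: UNIV_Times_UNIV[symmetric] sum.cartesian_product' sum_distrib_left mult.assoc
          del: UNIV_Times_UNIV)
    finally show "?h (?t3 x y z) = \<gamma> x y z" by simp
  next
    fix h
    assume h: "Vector_Spaces.linear (*s) (*) h \<and> (\<forall>x y z. h (?t3 x y z) = \<gamma> x y z)"
    have "h (axis (a, b, c) 1) = \<gamma> (axis a 1) (axis b 1) (axis c 1)" for a b c
      unfolding axis3[symmetric] using h by blast
    then have ax: "h (axis i 1) = \<gamma> (axis (fst i) 1) (axis (fst (snd i)) 1) (axis (snd (snd i)) 1)" for i
      by (cases i) simp
    show "h = ?h"
    proof
      fix t show "h t = ?h t"
        using linear_vec_coordinates[of "(*)" h t] h by (simp add: ax)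
    qed
  qed (rule linear_vec_weighted_sum)
qed

end

theory Submission
  imports Defs "HOL-Library.Function_Algebras"
begin

text \<open>
  Elements of \<open>A \<otimes> A\<close> and \<open>A \<otimes> A \<otimes> A\<close> are separated by the pairings with pure tensors of linear
  forms. Under these pairings \<open>\<Delta>\<close> becomes the convolution product on the dual space, the admissible
  differential coalgebra \<open>(A, \<Delta>, Q, P)\<close> becomes an admissible differential algebra with derivation
  \<open>f \<mapsto> f \<circ> Q\<close> and admissible operator \<open>f \<mapsto> f \<circ> P\<close>, and \<open>\<theta>\<close> becomes its product \<open>\<circ>\<close>. Hence the
  coalgebra axioms are the algebra axioms of the dual. The remaining compatibility conditions
  become scalar identities: all operators are moved onto the forms, with
  \<open>f(x \<cdot> Q(y)) = f(P(x) \<cdot> y) + f(Q(x \<cdot> y))\<close> and its dual, and what is left is the ASI condition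
  together with its symmetry in \<open>x\<close> and \<open>y\<close>.
\<close>

subsection \<open>Linear maps\<close>

lemma linear_map_add: "Vector_Spaces.linear s t f \<Longrightarrow> f (x + y) = f x + f y"
  by (auto simp: Vector_Spaces.linear_iff)

lemma linear_map_diff: "Vector_Spaces.linear s t f \<Longrightarrow> f (x - y) = f x - f y"
  by (metis add_diff_cancel_right' diff_add_cancel linear_map_add)

lemma linear_map_scale: "Vector_Spaces.linear s t f \<Longrightarrow> f (s c x) = t c (f x)"
  by (auto simp: Vector_Spaces.linear_iff)

lemma linear_map_pair: "Vector_Spaces.linear s t f \<Longrightarrow> vector_space_pair s t"
  by (simp add: Vector_Spaces.linear_iff vector_space_pair_def)

lemma linear_map_add_maps:
  "Vector_Spaces.linear s t f \<Longrightarrow> Vector_Spaces.linear s t g \<Longrightarrow>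
    Vector_Spaces.linear s t (\<lambda>x. f x + g x)"
  by (rule vector_space_pair.linear_compose_add[OF linear_map_pair])

lemma linear_map_diff_maps:
  "Vector_Spaces.linear s t f \<Longrightarrow> Vector_Spaces.linear s t g \<Longrightarrow>
    Vector_Spaces.linear s t (\<lambda>x. f x - g x)"
  by (rule vector_space_pair.linear_compose_sub[OF linear_map_pair])

lemma linear_map_scale_maps:
  "Vector_Spaces.linear s t f \<Longrightarrow> Vector_Spaces.linear s t (\<lambda>x. t c (f x))"
  by (rule vector_space_pair.linear_compose_scale_right[OF linear_map_pair])

lemma linear_map_comp:
  "Vector_Spaces.linear s t f \<Longrightarrow> Vector_Spaces.linear t u g \<Longrightarrow>
    Vector_Spaces.linear s u (\<lambda>x. g (f x))"
  using Vector_Spaces.linear_compose[of s t f u g] by (simp add: o_def)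

subsection \<open>Admissible commutative differential rings\<close>

text \<open>
  Relativised to a carrier \<open>V\<close> because the dual space, to which this is also applied, is only a
  subset of the type of functions. Scalars play no role.
\<close>

locale admissible_diff_ring =
  fixes V :: "'b::ab_group_add set" and mul :: "'b \<Rightarrow> 'b \<Rightarrow> 'b" and P Q :: "'b \<Rightarrow> 'b"
  assumes closed: "x \<in> V \<Longrightarrow> y \<in> V \<Longrightarrow> x + y \<in> V" "x \<in> V \<Longrightarrow> y \<in> V \<Longrightarrow> x - y \<in> V"
      "x \<in> V \<Longrightarrow> y \<in> V \<Longrightarrow> mul x y \<in> V" "x \<in> V \<Longrightarrow> P x \<in> V" "x \<in> V \<Longrightarrow> Q x \<in> V"
    and add: "x \<in> V \<Longrightarrow> y \<in> V \<Longrightarrow> z \<in> V \<Longrightarrow> mul x (y + z) = mul x y + mul x z"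
      "x \<in> V \<Longrightarrow> y \<in> V \<Longrightarrow> P (x + y) = P x + P y"
      "x \<in> V \<Longrightarrow> y \<in> V \<Longrightarrow> Q (x + y) = Q x + Q y"
    and comm: "x \<in> V \<Longrightarrow> y \<in> V \<Longrightarrow> mul x y = mul y x"
    and assoc: "x \<in> V \<Longrightarrow> y \<in> V \<Longrightarrow> z \<in> V \<Longrightarrow> mul (mul x y) z = mul x (mul y z)"
    and P_mul: "x \<in> V \<Longrightarrow> y \<in> V \<Longrightarrow> P (mul x y) = mul (P x) y + mul x (P y)"
    and mul_Q: "x \<in> V \<Longrightarrow> y \<in> V \<Longrightarrow> mul x (Q y) = mul (P x) y + Q (mul x y)"
begin

definition circ :: "'b \<Rightarrow> 'b \<Rightarrow> 'b"
  where "circ x y = Q (mul x y) - mul (P x) y"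

abbreviation bracket :: "'b \<Rightarrow> 'b \<Rightarrow> 'b"
  where "bracket x y \<equiv> circ x y - circ y x"

lemma diff:
  "x \<in> V \<Longrightarrow> y \<in> V \<Longrightarrow> z \<in> V \<Longrightarrow> mul x (y - z) = mul x y - mul x z"
  "x \<in> V \<Longrightarrow> y \<in> V \<Longrightarrow> P (x - y) = P x - P y"
  "x \<in> V \<Longrightarrow> y \<in> V \<Longrightarrow> Q (x - y) = Q x - Q y"
  by (metis add(1) closed(2) add_diff_cancel_right' diff_add_cancel,
      metis add(2) closed(2) add_diff_cancel_right' diff_add_cancel,
      metis add(3) closed(2) add_diff_cancel_right' diff_add_cancel)

lemma distrib_left:
  "x \<in> V \<Longrightarrow> y \<in> V \<Longrightarrow> z \<in> V \<Longrightarrow> mul (y + z) x = mul y x + mul z x"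
  "x \<in> V \<Longrightarrow> y \<in> V \<Longrightarrow> z \<in> V \<Longrightarrow> mul (y - z) x = mul y x - mul z x"
  by (simp_all add: comm[of _ x] closed add diff)

lemma left_commute: "x \<in> V \<Longrightarrow> y \<in> V \<Longrightarrow> z \<in> V \<Longrightarrow> mul x (mul y z) = mul y (mul x z)"
  by (metis assoc comm)

lemma Q_mul: "x \<in> V \<Longrightarrow> y \<in> V \<Longrightarrow> mul (Q y) x = mul (P x) y + Q (mul x y)"
  by (metis comm mul_Q closed(5))

text \<open>Rules for a normal form: sums are expanded, \<open>P\<close> is pushed into products by
  the Leibniz rule, \<open>Q\<close> is pulled out of them by admissibility. The permutative rules
  \<open>comm\<close> and \<open>left_commute\<close> are added only where factors must be
  sorted.\<close>

lemmas normalize = closed add diff distrib_left assoc P_mul mul_Q Q_mul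

section \<open>Identities of the product \<open>circ\<close>\<close>

lemma circ_closed: "x \<in> V \<Longrightarrow> y \<in> V \<Longrightarrow> circ x y \<in> V"
  by (simp add: circ_def closed)

lemma circ_diff:
  assumes "x \<in> V" "y \<in> V" "z \<in> V"
  shows "circ (x - y) z = circ x z - circ y z"
  using assms by (simp add: circ_def normalize)

text \<open>The terms \<open>Q (mul x y)\<close> and \<open>Q (mul y x)\<close> cancel, so the
  commutator depends on \<open>P\<close> alone: it is the Witt type bracket of a derivation.\<close>

lemma bracket_eq: "x \<in> V \<Longrightarrow> y \<in> V \<Longrightarrow> bracket x y = mul x (P y) - mul y (P x)"
  by (simp add: circ_def normalize comm left_commute)

text \<open>Two copies of \<open>Q (mul (P x) (mul y z))\<close> have cancelled here. The first and
  last terms are symmetric in \<open>x\<close> and \<open>y\<close>, so antisymmetrizing leaves just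
  the terms of \<open>bracket_circ\<close>.\<close>

lemma circ_circ:
  assumes "x \<in> V" "y \<in> V" "z \<in> V"
  shows "circ x (circ y z) = Q (Q (mul x (mul y z))) - Q (mul x (mul (P y) z))
    - mul (P (P x)) (mul y z) + mul (P x) (mul (P y) z)"
  using assms by (simp add: circ_def normalize algebra_simps)

text \<open>In this form the cyclic sum over \<open>x\<close>, \<open>y\<close>, \<open>z\<close>
  cancels in pairs, both under \<open>Q\<close> and among the terms with \<open>P\<close> applied
  twice.\<close>

lemma bracket_circ:
  assumes "x \<in> V" "y \<in> V" "z \<in> V"
  shows "circ (bracket x y) z = Q (mul (P y) (mul x z)) - Q (mul (P x) (mul y z))
    - mul x (mul (P (P y)) z) + mul y (mul (P (P x)) z)"
  using assms by (simp add: bracket_eq circ_def normalize algebra_simps comm left_commute)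

lemma anti_pre_Lie:
  assumes "x \<in> V" "y \<in> V" "z \<in> V"
  shows "circ x (circ y z) - circ y (circ x z) = circ (bracket y x) z"
  using assms by (simp add: circ_circ bracket_circ normalize comm left_commute)

lemma anti_pre_Lie_cyclic:
  assumes "x \<in> V" "y \<in> V" "z \<in> V"
  shows "circ (bracket x y) z + circ (bracket y z) x + circ (bracket z x) y = 0"
  using assms by (simp add: bracket_circ normalize comm left_commute)

lemma Jacobi:
  assumes "x \<in> V" "y \<in> V" "z \<in> V"
  shows "bracket x (bracket y z) + bracket y (bracket z x) + bracket z (bracket x y) = 0"
  \<comment> \<open>Two stages: the difference patterns of \<open>bracket\<close> stay intact until
    \<open>bracket_eq\<close> has removed them, and only then are terms rearranged.\<close>
  using assms by (simp add: bracket_eq normalize) (simp add: algebra_simps normalize comm left_commute)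

lemma P_bracket:
  assumes "x \<in> V" "y \<in> V"
  shows "P (bracket x y) = bracket (P x) y + bracket x (P y)"
  using assms by (simp add: bracket_eq normalize comm)

lemma relative_Leibniz:
  assumes "x \<in> V" "y \<in> V" "z \<in> V"
  shows "bracket z (mul x y) = mul (bracket z x) y + mul x (bracket z y) + mul (mul x y) (P z)"
  using assms by (simp add: bracket_eq normalize) (simp add: algebra_simps normalize comm left_commute)

lemma circ_Q:
  assumes "x \<in> V" "y \<in> V"
  shows "circ x (Q y) - circ (P x) y - Q (circ x y) = 0"
  using assms by (simp add: circ_def normalize)

lemma mul_circ:
  assumes "x \<in> V" "y \<in> V" "z \<in> V"
  shows "mul x (circ y z) - circ y (mul x z) + mul (bracket x y) z - mul (mul x (P y)) z = 0"
  \<comment> \<open>\<open>circ\<close> stays folded until \<open>bracket_eq\<close> has removed the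
    bracket, since unfolding it would destroy the pattern of that rule.\<close>
  using assms by (simp add: bracket_eq normalize circ_closed)
    (simp add: circ_def normalize comm left_commute)

lemma circ_mul:
  assumes "x \<in> V" "y \<in> V" "z \<in> V"
  shows "circ (mul x y) z - circ y (mul x z) - circ x (mul y z) + Q (mul (mul x y) z) = 0"
  using assms by (simp add: circ_def normalize comm left_commute)

end

subsection \<open>Pairing tensors with linear forms\<close>

context tensor_powers
begin

section \<open>Uniqueness and existence of lifts\<close>

lemma bilinear_map_comp:
  "bilinear_map s t \<beta> \<Longrightarrow> Vector_Spaces.linear t u g \<Longrightarrow> bilinear_map s u (\<lambda>x y. g (\<beta> x y))"
  by (auto simp: bilinear_map_def intro: linear_map_comp)

lemma trilinear_map_comp:
  "trilinear_map s t \<beta> \<Longrightarrow> Vector_Spaces.linear t u g \<Longrightarrow> trilinear_map s u (\<lambda>x y z. g (\<beta> x y z))"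
  by (auto simp: trilinear_map_def intro: linear_map_comp[where t = t and g = g])

text \<open>The uniqueness half of the universal property, applied to the bilinear map that
  \<open>g\<close> itself induces on pure tensors.\<close>

lemma linear_tens2_eqI:
  assumes "Vector_Spaces.linear scale2 sw g" "Vector_Spaces.linear scale2 sw h"
    and "\<And>x y. g (tens2 x y) = h (tens2 x y)"
  shows "g t = h t"
proof -
  have "g = h"
    by (rule ex1_unique[OF universal_bilinear[OF bilinear_map_comp[OF bilinear_tens2 assms(1)]]])
      (use assms in auto)
  then show ?thesis by simp
qed

lemma linear_tens3_eqI:
  assumes "Vector_Spaces.linear scale3 sw g" "Vector_Spaces.linear scale3 sw h"
    and "\<And>x y z. g (tens3 x y z) = h (tens3 x y z)"
  shows "g t = h t"
proof -
  have "g = h"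
    by (rule ex1_unique[OF universal_trilinear[OF trilinear_map_comp[OF trilinear_tens3 assms(1)]]])
      (use assms in auto)
  then show ?thesis by simp
qed

lemma
  assumes "bilinear_map scale sw \<beta>"
  shows linear_lift2: "Vector_Spaces.linear scale2 sw (lift2 sw \<beta>)"
    and lift2_tens2: "lift2 sw \<beta> (tens2 x y) = \<beta> x y"
  unfolding lift2_def using theI'[OF universal_bilinear[OF assms]] by auto

lemma
  assumes "trilinear_map scale sw \<gamma>"
  shows linear_lift3: "Vector_Spaces.linear scale3 sw (lift3 sw \<gamma>)"
    and lift3_tens3: "lift3 sw \<gamma> (tens3 x y z) = \<gamma> x y z"
  unfolding lift3_def using theI'[OF universal_trilinear[OF assms]] by auto

lemma linear_tens2: "Vector_Spaces.linear scale scale2 (\<lambda>x. tens2 x y)"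
    "Vector_Spaces.linear scale scale2 (tens2 x)"
  using bilinear_tens2 by (auto simp: bilinear_map_def)

lemma linear_tens3: "Vector_Spaces.linear scale scale3 (\<lambda>x. tens3 x y z)"
    "Vector_Spaces.linear scale scale3 (\<lambda>y. tens3 x y z)"
    "Vector_Spaces.linear scale scale3 (tens3 x y)"
  using trilinear_tens3 by (auto simp: trilinear_map_def)

text \<open>Supplies linearity of \<open>id_ten\<close> and \<open>ten_id\<close> in the leg that is
  left alone, which enters the inner lift only as a parameter.\<close>

lemma linear_lift2_parameter:
  assumes "\<And>x. bilinear_map scale sw (\<gamma> x)" "\<And>b c. Vector_Spaces.linear scale sw (\<lambda>x. \<gamma> x b c)"
  shows "Vector_Spaces.linear scale sw (\<lambda>x. lift2 sw (\<gamma> x) t)"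
proof (rule vector_space_linearI[OF vector_space_axioms])
  show "vector_space sw" using assms(2) by (auto simp: Vector_Spaces.linear_iff)
  show "lift2 sw (\<gamma> (x + y)) t = lift2 sw (\<gamma> x) t + lift2 sw (\<gamma> y) t" for x y
  proof (rule linear_tens2_eqI[where sw = sw])
    show "lift2 sw (\<gamma> (x + y)) (tens2 a b) = lift2 sw (\<gamma> x) (tens2 a b) + lift2 sw (\<gamma> y) (tens2 a b)"
      for a b
      unfolding lift2_tens2[OF assms(1)] by (rule linear_map_add[OF assms(2)])
  qed (intro linear_lift2 linear_map_add_maps assms(1))+
  show "lift2 sw (\<gamma> (scale c x)) t = sw c (lift2 sw (\<gamma> x) t)" for c x
  proof (rule linear_tens2_eqI[where sw = sw])
    show "lift2 sw (\<gamma> (scale c x)) (tens2 a b) = sw c (lift2 sw (\<gamma> x) (tens2 a b))" for a b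
      unfolding lift2_tens2[OF assms(1)] by (rule linear_map_scale[OF assms(2)])
  qed (intro linear_lift2 linear_map_scale_maps assms(1))+
qed

section \<open>Induced maps on pure tensors\<close>

lemma
  shows linear_tau: "Vector_Spaces.linear scale2 scale2 tau"
    and tau_tens2: "tau (tens2 x y) = tens2 y x"
proof -
  have "bilinear_map scale scale2 (\<lambda>x y. tens2 y x)"
    using linear_tens2 by (auto simp: bilinear_map_def)
  from linear_lift2[OF this] lift2_tens2[OF this]
  show "Vector_Spaces.linear scale2 scale2 tau" "tau (tens2 x y) = tens2 y x"
    by (auto simp: tau_def)
qed

lemma
  assumes "Vector_Spaces.linear scale scale p" "Vector_Spaces.linear scale scale q"
  shows linear_map2: "Vector_Spaces.linear scale2 scale2 (map2 p q)"
    and map2_tens2: "map2 p q (tens2 x y) = tens2 (p x) (q y)"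
proof -
  have "bilinear_map scale scale2 (\<lambda>x y. tens2 (p x) (q y))"
    using linear_map_comp[OF assms(1) linear_tens2(1)] linear_map_comp[OF assms(2) linear_tens2(2)]
    by (auto simp: bilinear_map_def)
  from linear_lift2[OF this] lift2_tens2[OF this]
  show "Vector_Spaces.linear scale2 scale2 (map2 p q)" "map2 p q (tens2 x y) = tens2 (p x) (q y)"
    by (auto simp: map2_def)
qed

lemma
  shows linear_xi: "Vector_Spaces.linear scale3 scale3 xi"
    and xi_tens3: "xi (tens3 x y z) = tens3 y z x"
proof -
  have "trilinear_map scale scale3 (\<lambda>x y z. tens3 y z x)"
    using linear_tens3 by (auto simp: trilinear_map_def)
  from linear_lift3[OF this] lift3_tens3[OF this]
  show "Vector_Spaces.linear scale3 scale3 xi" "xi (tens3 x y z) = tens3 y z x"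
    by (auto simp: xi_def)
qed

lemma
  shows linear_tau_id: "Vector_Spaces.linear scale3 scale3 tau_id"
    and tau_id_tens3: "tau_id (tens3 x y z) = tens3 y x z"
proof -
  have "trilinear_map scale scale3 (\<lambda>x y z. tens3 y x z)"
    using linear_tens3 by (auto simp: trilinear_map_def)
  from linear_lift3[OF this] lift3_tens3[OF this]
  show "Vector_Spaces.linear scale3 scale3 tau_id" "tau_id (tens3 x y z) = tens3 y x z"
    by (auto simp: tau_id_def)
qed

lemma
  assumes "Vector_Spaces.linear scale scale p" "Vector_Spaces.linear scale scale q"
    "Vector_Spaces.linear scale scale r"
  shows linear_map3: "Vector_Spaces.linear scale3 scale3 (map3 p q r)"
    and map3_tens3: "map3 p q r (tens3 x y z) = tens3 (p x) (q y) (r z)"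
proof -
  have "trilinear_map scale scale3 (\<lambda>x y z. tens3 (p x) (q y) (r z))"
    using linear_map_comp[OF assms(1) linear_tens3(1)] linear_map_comp[OF assms(2) linear_tens3(2)]
      linear_map_comp[OF assms(3) linear_tens3(3)]
    by (auto simp: trilinear_map_def)
  from linear_lift3[OF this] lift3_tens3[OF this]
  show "Vector_Spaces.linear scale3 scale3 (map3 p q r)"
    "map3 p q r (tens3 x y z) = tens3 (p x) (q y) (r z)"
    by (auto simp: map3_def)
qed

lemma bilinear_tens3:
  "bilinear_map scale scale3 (tens3 x)" "bilinear_map scale scale3 (\<lambda>a b. tens3 a b z)"
  using linear_tens3 by (auto simp: bilinear_map_def)

lemma
  assumes "linear_comult F"
  shows linear_id_ten: "Vector_Spaces.linear scale2 scale3 (id_ten F)"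
    and id_ten_tens2: "id_ten F (tens2 x y) = lift2 scale3 (tens3 x) (F y)"
proof -
  have "Vector_Spaces.linear scale scale3 (\<lambda>y. lift2 scale3 (tens3 x) (F y))" for x
    by (rule linear_map_comp[OF _ linear_lift2[OF bilinear_tens3(1)]])
      (use assms in \<open>simp add: linear_comult_def\<close>)
  moreover have "Vector_Spaces.linear scale scale3 (\<lambda>x. lift2 scale3 (tens3 x) (F y))" for y
    by (rule linear_lift2_parameter) (rule bilinear_tens3 linear_tens3)+
  ultimately have "bilinear_map scale scale3 (\<lambda>x y. lift2 scale3 (tens3 x) (F y))"
    by (simp add: bilinear_map_def)
  from linear_lift2[OF this] lift2_tens2[OF this]
  show "Vector_Spaces.linear scale2 scale3 (id_ten F)"
    "id_ten F (tens2 x y) = lift2 scale3 (tens3 x) (F y)"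
    by (auto simp: id_ten_def)
qed

lemma
  assumes "linear_comult F"
  shows linear_ten_id: "Vector_Spaces.linear scale2 scale3 (ten_id F)"
    and ten_id_tens2: "ten_id F (tens2 x y) = lift2 scale3 (\<lambda>a b. tens3 a b y) (F x)"
proof -
  have "Vector_Spaces.linear scale scale3 (\<lambda>x. lift2 scale3 (\<lambda>a b. tens3 a b y) (F x))" for y
    by (rule linear_map_comp[OF _ linear_lift2[OF bilinear_tens3(2)]])
      (use assms in \<open>simp add: linear_comult_def\<close>)
  moreover have "Vector_Spaces.linear scale scale3 (\<lambda>y. lift2 scale3 (\<lambda>a b. tens3 a b y) (F x))" for x
    by (rule linear_lift2_parameter) (rule bilinear_tens3 linear_tens3)+
  ultimately have "bilinear_map scale scale3 (\<lambda>x y. lift2 scale3 (\<lambda>a b. tens3 a b y) (F x))"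
    by (simp add: bilinear_map_def)
  from linear_lift2[OF this] lift2_tens2[OF this]
  show "Vector_Spaces.linear scale2 scale3 (ten_id F)"
    "ten_id F (tens2 x y) = lift2 scale3 (\<lambda>a b. tens3 a b y) (F x)"
    by (auto simp: ten_id_def)
qed

section \<open>Linear forms, pairings and separation of tensors\<close>

definition forms :: "('a \<Rightarrow> 'k) set"
  where "forms = {f. Vector_Spaces.linear scale (*) f}"

definition pair2 :: "('a \<Rightarrow> 'k) \<Rightarrow> ('a \<Rightarrow> 'k) \<Rightarrow> 't \<Rightarrow> 'k"
  where "pair2 f g = lift2 (*) (\<lambda>x y. f x * g y)"

definition pair3 :: "('a \<Rightarrow> 'k) \<Rightarrow> ('a \<Rightarrow> 'k) \<Rightarrow> ('a \<Rightarrow> 'k) \<Rightarrow> 'u \<Rightarrow> 'k"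
  where "pair3 f g h = lift3 (*) (\<lambda>x y z. f x * g y * h z)"

lemma
  assumes "f \<in> forms" "g \<in> forms"
  shows linear_pair2: "Vector_Spaces.linear scale2 (*) (pair2 f g)"
    and pair2_tens2: "pair2 f g (tens2 x y) = f x * g y"
proof -
  have "bilinear_map scale (*) (\<lambda>x y. f x * g y)"
    using assms by (auto simp: bilinear_map_def forms_def intro!: linear_scale_form)
  from linear_lift2[OF this] lift2_tens2[OF this]
  show "Vector_Spaces.linear scale2 (*) (pair2 f g)" "pair2 f g (tens2 x y) = f x * g y"
    by (auto simp: pair2_def)
qed

lemma
  assumes "f \<in> forms" "g \<in> forms" "h \<in> forms"
  shows linear_pair3: "Vector_Spaces.linear scale3 (*) (pair3 f g h)"
    and pair3_tens3: "pair3 f g h (tens3 x y z) = f x * g y * h z"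
proof -
  have "trilinear_map scale (*) (\<lambda>x y z. f x * g y * h z)"
    using assms by (auto simp: trilinear_map_def forms_def intro!: linear_scale_form)
  from linear_lift3[OF this] lift3_tens3[OF this]
  show "Vector_Spaces.linear scale3 (*) (pair3 f g h)" "pair3 f g h (tens3 x y z) = f x * g y * h z"
    by (auto simp: pair3_def)
qed

lemma coordinate_in_forms: "(\<lambda>x. representation Basis x b) \<in> forms"
  by (simp add: forms_def linear_coordinate)

text \<open>Pairings with products of coordinate forms are the dual basis of the products of basis
  vectors. Both sides are linear in \<open>t\<close>, so pure tensors suffice.\<close>

lemma tens2_expansion:
  "t = (\<Sum>i\<in>Basis \<times> Basis. scale2 (pair2 (\<lambda>x. representation Basis x (fst i))
    (\<lambda>x. representation Basis x (snd i)) t) (tens2 (fst i) (snd i)))"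
proof (rule linear_tens2_eqI[of scale2 "\<lambda>t. t"])
  show "Vector_Spaces.linear scale2 scale2 (\<lambda>t. t)"
    by (simp add: Vector_Spaces.linear_iff sq.vector_space_axioms)
  show "Vector_Spaces.linear scale2 scale2 (\<lambda>t. \<Sum>i\<in>Basis \<times> Basis. scale2 (pair2
      (\<lambda>x. representation Basis x (fst i)) (\<lambda>x. representation Basis x (snd i)) t) (tens2 (fst i) (snd i)))"
    by (intro linear_weighted_sum sq.vector_space_axioms linear_pair2 coordinate_in_forms)
  let ?r = "representation Basis"
  fix x y
  have "tens2 x y = (\<Sum>b\<in>Basis. scale2 (?r x b) (tens2 b y))"
    by (rule linear_sum_coordinates[OF linear_tens2(1)])
  also have "\<dots> = (\<Sum>b\<in>Basis. scale2 (?r x b) (\<Sum>c\<in>Basis. scale2 (?r y c) (tens2 b c)))"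
    \<comment> \<open>Read from right to left, the rule collapses the inner sum; as a forward
      rewrite rule it would loop.\<close>
    by (simp only: linear_sum_coordinates[OF linear_tens2(2), symmetric])
  also have "\<dots> = (\<Sum>i\<in>Basis \<times> Basis. scale2 (pair2 (\<lambda>x. ?r x (fst i)) (\<lambda>x. ?r x (snd i)) (tens2 x y))
      (tens2 (fst i) (snd i)))"
    by (simp add: pair2_tens2 coordinate_in_forms sum.cartesian_product' sq.scale_sum_right)
  finally show "tens2 x y = \<dots>" .
qed

lemma tens3_expansion:
  "t = (\<Sum>i\<in>Basis \<times> Basis \<times> Basis. scale3 (pair3 (\<lambda>x. representation Basis x (fst i))
    (\<lambda>x. representation Basis x (fst (snd i))) (\<lambda>x. representation Basis x (snd (snd i))) t)
    (tens3 (fst i) (fst (snd i)) (snd (snd i))))"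
proof (rule linear_tens3_eqI[of scale3 "\<lambda>t. t"])
  show "Vector_Spaces.linear scale3 scale3 (\<lambda>t. t)"
    by (simp add: Vector_Spaces.linear_iff cu.vector_space_axioms)
  show "Vector_Spaces.linear scale3 scale3 (\<lambda>t. \<Sum>i\<in>Basis \<times> Basis \<times> Basis. scale3 (pair3
      (\<lambda>x. representation Basis x (fst i)) (\<lambda>x. representation Basis x (fst (snd i)))
      (\<lambda>x. representation Basis x (snd (snd i))) t) (tens3 (fst i) (fst (snd i)) (snd (snd i))))"
    by (intro linear_weighted_sum cu.vector_space_axioms linear_pair3 coordinate_in_forms)
  let ?r = "representation Basis"
  fix x y z
  have "tens3 x y z = (\<Sum>b\<in>Basis. scale3 (?r x b) (tens3 b y z))"
    by (rule linear_sum_coordinates[OF linear_tens3(1)])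
  also have "\<dots> = (\<Sum>b\<in>Basis. scale3 (?r x b) (\<Sum>c\<in>Basis. scale3 (?r y c) (tens3 b c z)))"
    by (simp only: linear_sum_coordinates[OF linear_tens3(2), symmetric])
  also have "\<dots> = (\<Sum>b\<in>Basis. scale3 (?r x b) (\<Sum>c\<in>Basis. scale3 (?r y c)
      (\<Sum>d\<in>Basis. scale3 (?r z d) (tens3 b c d))))"
    by (simp only: linear_sum_coordinates[OF linear_tens3(3), symmetric])
  also have "\<dots> = (\<Sum>i\<in>Basis \<times> Basis \<times> Basis. scale3 (pair3 (\<lambda>x. ?r x (fst i))
      (\<lambda>x. ?r x (fst (snd i))) (\<lambda>x. ?r x (snd (snd i))) (tens3 x y z))
      (tens3 (fst i) (fst (snd i)) (snd (snd i))))"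
    by (simp add: pair3_tens3 coordinate_in_forms sum.cartesian_product' cu.scale_sum_right mult.assoc)
  finally show "tens3 x y z = \<dots>" .
qed

text \<open>By the basis expansion a tensor is determined by its pairings with coordinate forms.
  This reduces every tensor identity below to a scalar one.\<close>

lemma pair2_eqI:
  assumes "\<And>f g. f \<in> forms \<Longrightarrow> g \<in> forms \<Longrightarrow> pair2 f g s = pair2 f g t"
  shows "s = t"
  by (subst tens2_expansion, subst (2) tens2_expansion) (simp add: assms coordinate_in_forms)

lemma pair3_eqI:
  assumes "\<And>f g h. f \<in> forms \<Longrightarrow> g \<in> forms \<Longrightarrow> h \<in> forms \<Longrightarrow> pair3 f g h s = pair3 f g h t"
  shows "s = t"
  by (subst tens3_expansion, subst (2) tens3_expansion) (simp add: assms coordinate_in_forms)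

lemma forms_comp: "f \<in> forms \<Longrightarrow> Vector_Spaces.linear scale scale p \<Longrightarrow> f \<circ> p \<in> forms"
  by (auto simp: forms_def o_def intro: linear_map_comp)

lemma forms_pair2: "f \<in> forms \<Longrightarrow> g \<in> forms \<Longrightarrow> linear_comult F \<Longrightarrow> pair2 f g \<circ> F \<in> forms"
  unfolding forms_def linear_comult_def o_def
  by (auto intro!: linear_map_comp[OF _ linear_pair2] simp: forms_def)

lemma forms_add_diff:
  "f \<in> forms \<Longrightarrow> g \<in> forms \<Longrightarrow> f + g \<in> forms" "f \<in> forms \<Longrightarrow> g \<in> forms \<Longrightarrow> f - g \<in> forms"
  by (simp_all add: forms_def plus_fun_def fun_diff_def linear_map_add_maps linear_map_diff_maps)

lemma pair2_add_diff:
  assumes "f \<in> forms" "g \<in> forms"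
  shows "pair2 f g (s + t) = pair2 f g s + pair2 f g t" "pair2 f g (s - t) = pair2 f g s - pair2 f g t"
    "pair2 f g 0 = 0"
  using linear_map_add[OF linear_pair2[OF assms]] linear_map_diff[OF linear_pair2[OF assms]]
  by (auto, metis cancel_comm_monoid_add_class.diff_cancel)

lemma pair3_add_diff:
  assumes "f \<in> forms" "g \<in> forms" "h \<in> forms"
  shows "pair3 f g h (s + t) = pair3 f g h s + pair3 f g h t"
    "pair3 f g h (s - t) = pair3 f g h s - pair3 f g h t" "pair3 f g h 0 = 0"
  using linear_map_add[OF linear_pair3[OF assms]] linear_map_diff[OF linear_pair3[OF assms]]
  by (auto, metis cancel_comm_monoid_add_class.diff_cancel)

text \<open>Additivity in the form, not in the tensor: this becomes distributivity of the product on
  the dual space.\<close>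

lemma pair2_form_add:
  assumes "f \<in> forms" "g \<in> forms" "h \<in> forms"
  shows "pair2 f (g + h) t = pair2 f g t + pair2 f h t"
proof (rule linear_tens2_eqI[where sw = "(*)"])
  show "pair2 f (g + h) (tens2 x y) = pair2 f g (tens2 x y) + pair2 f h (tens2 x y)" for x y
    using assms by (simp add: pair2_tens2 forms_add_diff(1) algebra_simps)
qed (intro linear_pair2 linear_map_add_maps forms_add_diff assms)+

section \<open>Transposes of the induced maps\<close>

lemma pair2_tau:
  assumes "f \<in> forms" "g \<in> forms"
  shows "pair2 f g (tau t) = pair2 g f t"
  by (rule linear_tens2_eqI[OF linear_map_comp[OF linear_tau linear_pair2]])
    (use assms in \<open>auto intro!: linear_pair2 simp: pair2_tens2 tau_tens2\<close>)

lemma pair2_map2: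
  assumes "f \<in> forms" "g \<in> forms" "Vector_Spaces.linear scale scale p" "Vector_Spaces.linear scale scale q"
  shows "pair2 f g (map2 p q t) = pair2 (f \<circ> p) (g \<circ> q) t"
proof (rule linear_tens2_eqI[OF linear_map_comp[OF linear_map2 linear_pair2] linear_pair2])
  have comp: "f \<circ> p \<in> forms" "g \<circ> q \<in> forms"
    using assms by (simp_all add: forms_comp)
  show "pair2 f g (map2 p q (tens2 x y)) = pair2 (f \<circ> p) (g \<circ> q) (tens2 x y)" for x y
    unfolding map2_tens2[OF assms(3,4)] pair2_tens2[OF assms(1,2)] pair2_tens2[OF comp] by simp
qed (intro assms forms_comp)+

lemma pair3_xi:
  assumes "f \<in> forms" "g \<in> forms" "h \<in> forms"
  shows "pair3 f g h (xi t) = pair3 h f g t"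
  by (rule linear_tens3_eqI[OF linear_map_comp[OF linear_xi linear_pair3]])
    (use assms in \<open>auto intro!: linear_pair3 simp: pair3_tens3 xi_tens3\<close>)

lemma pair3_tau_id:
  assumes "f \<in> forms" "g \<in> forms" "h \<in> forms"
  shows "pair3 f g h (tau_id t) = pair3 g f h t"
  by (rule linear_tens3_eqI[OF linear_map_comp[OF linear_tau_id linear_pair3]])
    (use assms in \<open>auto intro!: linear_pair3 simp: pair3_tens3 tau_id_tens3\<close>)

lemma pair3_map3:
  assumes "f \<in> forms" "g \<in> forms" "h \<in> forms" "Vector_Spaces.linear scale scale p"
    "Vector_Spaces.linear scale scale q" "Vector_Spaces.linear scale scale r"
  shows "pair3 f g h (map3 p q r t) = pair3 (f \<circ> p) (g \<circ> q) (h \<circ> r) t"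
proof (rule linear_tens3_eqI[OF linear_map_comp[OF linear_map3 linear_pair3] linear_pair3])
  have comp: "f \<circ> p \<in> forms" "g \<circ> q \<in> forms" "h \<circ> r \<in> forms"
    using assms by (simp_all add: forms_comp)
  show "pair3 f g h (map3 p q r (tens3 x y z)) = pair3 (f \<circ> p) (g \<circ> q) (h \<circ> r) (tens3 x y z)"
    for x y z
    unfolding map3_tens3[OF assms(4-6)] pair3_tens3[OF assms(1-3)] pair3_tens3[OF comp] by simp
qed (intro assms forms_comp)+

lemma pair3_lift2:
  assumes "f \<in> forms" "g \<in> forms" "h \<in> forms"
  shows "pair3 f g h (lift2 scale3 (tens3 x) t) = f x * pair2 g h t"
    and "pair3 f g h (lift2 scale3 (\<lambda>a b. tens3 a b x) t) = pair2 f g t * h x"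
  subgoal
    by (rule linear_tens2_eqI[OF linear_map_comp[OF linear_lift2[OF bilinear_tens3(1)] linear_pair3]])
      (use assms in \<open>auto intro!: linear_pair2 linear_scale_form
        simp: lift2_tens2 bilinear_tens3 pair2_tens2 pair3_tens3\<close>)
  subgoal
    by (rule linear_tens2_eqI[OF linear_map_comp[OF linear_lift2[OF bilinear_tens3(2)] linear_pair3]])
      (use assms in \<open>auto intro!: linear_pair2 linear_scale_form
        simp: lift2_tens2 bilinear_tens3 pair2_tens2 pair3_tens3\<close>)
  done

text \<open>Contracting first the two legs created by \<open>F\<close> merges \<open>g\<close> and
  \<open>h\<close> into one form, so iterated comultiplications turn into nested products of
  forms.\<close>

lemma pair3_id_ten:
  assumes "f \<in> forms" "g \<in> forms" "h \<in> forms" "linear_comult F"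
  shows "pair3 f g h (id_ten F t) = pair2 f (pair2 g h \<circ> F) t"
proof (rule linear_tens2_eqI[OF linear_map_comp[OF linear_id_ten linear_pair3] linear_pair2])
  show "pair3 f g h (id_ten F (tens2 x y)) = pair2 f (pair2 g h \<circ> F) (tens2 x y)" for x y
    unfolding id_ten_tens2[OF assms(4)] pair3_lift2[OF assms(1-3)]
      pair2_tens2[OF assms(1) forms_pair2[OF assms(2-4)]] by simp
qed (intro assms forms_pair2)+

lemma pair3_ten_id:
  assumes "f \<in> forms" "g \<in> forms" "h \<in> forms" "linear_comult F"
  shows "pair3 f g h (ten_id F t) = pair2 (pair2 f g \<circ> F) h t"
proof (rule linear_tens2_eqI[OF linear_map_comp[OF linear_ten_id linear_pair3] linear_pair2])
  show "pair3 f g h (ten_id F (tens2 x y)) = pair2 (pair2 f g \<circ> F) h (tens2 x y)" for x y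
    unfolding ten_id_tens2[OF assms(4)] pair3_lift2[OF assms(1-3)]
      pair2_tens2[OF forms_pair2[OF assms(1,2,4)] assms(3)] by simp
qed (intro assms forms_pair2)+

end


subsection \<open>Differential ASI bialgebras\<close>

locale diff_ASI_bialgebra = tensor_powers scale Basis scale2 scale3 tens2 tens3
  for scale :: "'k::field \<Rightarrow> 'a::ab_group_add \<Rightarrow> 'a" and Basis :: "'a set"
    and scale2 :: "'k \<Rightarrow> 't::ab_group_add \<Rightarrow> 't"
    and scale3 :: "'k \<Rightarrow> 'u::ab_group_add \<Rightarrow> 'u"
    and tens2 :: "'a \<Rightarrow> 'a \<Rightarrow> 't"
    and tens3 :: "'a \<Rightarrow> 'a \<Rightarrow> 'a \<Rightarrow> 'u" +
  fixes mul :: "'a \<Rightarrow> 'a \<Rightarrow> 'a" and \<Delta> :: "'a \<Rightarrow> 't" and P Q :: "'a \<Rightarrow> 'a"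
  assumes bialgebra: "comm_cocomm_diff_ASI_bialgebra mul \<Delta> P Q"
begin

lemmas bialgebra_unfolded = bialgebra[unfolded comm_cocomm_diff_ASI_bialgebra_def
    comm_cocomm_ASI_bialgebra_def admissible_comm_diff_algebra_def
    admissible_cocomm_diff_coalgebra_def cocomm_coassoc_coalgebra_def comm_assoc_algebra_def
    derivation_def bilinear_map_def linear_endo_def]

lemma linear_maps:
  "Vector_Spaces.linear scale scale P" "Vector_Spaces.linear scale scale Q"
  "Vector_Spaces.linear scale scale (mul x)" "Vector_Spaces.linear scale scale (\<lambda>y. mul y x)"
  "Vector_Spaces.linear scale scale id" "linear_comult \<Delta>"
  using bialgebra_unfolded by (auto simp: Vector_Spaces.linear_iff)

section \<open>The convolution product on the dual space\<close>

definition conv :: "('a \<Rightarrow> 'k) \<Rightarrow> ('a \<Rightarrow> 'k) \<Rightarrow> 'a \<Rightarrow> 'k"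
  where "conv f g = pair2 f g \<circ> \<Delta>"

lemma conv_closed: "f \<in> forms \<Longrightarrow> g \<in> forms \<Longrightarrow> conv f g \<in> forms"
  unfolding conv_def by (simp add: forms_pair2 linear_maps)

lemma pair2_Delta: "pair2 f g (\<Delta> x) = conv f g x"
  by (simp add: conv_def)

lemma form_diff: "f \<in> forms \<Longrightarrow> f (x - y) = f x - f y"
  unfolding forms_def by (simp add: linear_map_diff)

lemma form_add: "f \<in> forms \<Longrightarrow> f (x + y) = f x + f y"
  unfolding forms_def by (simp add: linear_map_add)

lemma conv_comm:
  assumes "f \<in> forms" "g \<in> forms"
  shows "conv f g = conv g f"
proof
  fix x
  have "\<Delta> x = tau (\<Delta> x)" using bialgebra_unfolded by simp
  then show "conv f g x = conv g f x"
    using assms by (metis pair2_tau pair2_Delta)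
qed

text \<open>Coassociativity tested on three forms: \<open>ten_id\<close> yields the left bracketing
  and \<open>id_ten\<close> the right one.\<close>

lemma conv_assoc:
  assumes "f \<in> forms" "g \<in> forms" "h \<in> forms"
  shows "conv (conv f g) h = conv f (conv g h)"
proof
  fix x
  have "id_ten \<Delta> (\<Delta> x) = ten_id \<Delta> (\<Delta> x)" using bialgebra_unfolded by simp
  then have "pair3 f g h (id_ten \<Delta> (\<Delta> x)) = pair3 f g h (ten_id \<Delta> (\<Delta> x))" by simp
  then show "conv (conv f g) h x = conv f (conv g h) x"
    using assms by (simp add: pair3_id_ten pair3_ten_id linear_maps pair2_Delta flip: conv_def)
qed

lemma conv_Q:
  assumes "f \<in> forms" "g \<in> forms"
  shows "conv f g (Q x) = conv (f \<circ> Q) g x + conv f (g \<circ> Q) x"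
proof -
  have "\<Delta> (Q x) = map2 Q id (\<Delta> x) + map2 id Q (\<Delta> x)" using bialgebra_unfolded by simp
  then have "pair2 f g (\<Delta> (Q x)) = pair2 f g (map2 Q id (\<Delta> x) + map2 id Q (\<Delta> x))" by simp
  then show ?thesis
    using assms by (simp add: pair2_map2 pair2_add_diff linear_maps pair2_Delta)
qed

lemma conv_P:
  assumes "f \<in> forms" "g \<in> forms"
  shows "conv f g (P x) = conv f (g \<circ> P) x - conv (f \<circ> Q) g x"
proof -
  have "\<Delta> (P x) = map2 id P (\<Delta> x) - map2 Q id (\<Delta> x)" using bialgebra_unfolded by simp
  then have "pair2 f g (\<Delta> (P x)) = pair2 f g (map2 id P (\<Delta> x) - map2 Q id (\<Delta> x))" by simp
  then show ?thesis
    using assms by (simp add: pair2_map2 pair2_add_diff linear_maps pair2_Delta)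
qed

text \<open>The ASI condition paired with two forms, with multiplications transposed onto the
  forms.\<close>

lemma conv_mul:
  assumes "f \<in> forms" "g \<in> forms"
  shows "conv f g (mul x y) = conv (f \<circ> mul x) g y + conv f (g \<circ> mul y) x"
proof -
  have "\<Delta> (mul x y) = map2 (mul x) id (\<Delta> y) + map2 id (mul y) (\<Delta> x)"
    using bialgebra_unfolded by simp
  then have "pair2 f g (\<Delta> (mul x y)) = pair2 f g (map2 (mul x) id (\<Delta> y) + map2 id (mul y) (\<Delta> x))"
    by simp
  then show ?thesis
    using assms by (simp add: pair2_map2 pair2_add_diff linear_maps pair2_Delta)
qed

sublocale alg: admissible_diff_ring UNIV mul P Q
proof unfold_locales
  fix x y z
  show "mul (mul x y) z = mul x (mul y z)" "mul x y = mul y x" "P (mul x y) = mul (P x) y + mul x (P y)"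
    using bialgebra_unfolded by blast+
  have "mul x (Q y) - mul (P x) y - Q (mul x y) = 0" using bialgebra_unfolded by blast
  then show "mul x (Q y) = mul (P x) y + Q (mul x y)" by (simp add: algebra_simps)
qed (auto simp: linear_map_add[OF linear_maps(1)] linear_map_add[OF linear_maps(2)]
    linear_map_add[OF linear_maps(3)])

text \<open>\<open>P\<close> and \<open>Q\<close> exchange roles under transposition. Sums of forms
  are pointwise, through the group structure on functions.\<close>

sublocale dual: admissible_diff_ring forms conv "\<lambda>f. f \<circ> Q" "\<lambda>f. f \<circ> P"
proof unfold_locales
  fix f g h assume fgh: "f \<in> forms" "g \<in> forms" "h \<in> forms"
  show "conv f (g + h) = conv f g + conv f h"
    using fgh by (auto simp: conv_def pair2_form_add)
  show "conv (conv f g) h = conv f (conv g h)"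
    using fgh by (rule conv_assoc)
next
  fix f g assume "f \<in> forms" "g \<in> forms"
  then show "conv f g \<circ> Q = conv (f \<circ> Q) g + conv f (g \<circ> Q)"
    "conv f (g \<circ> P) = conv (f \<circ> Q) g + (conv f g \<circ> P)"
    by (auto simp: conv_Q conv_P)
qed (auto simp: forms_add_diff conv_closed forms_comp linear_maps intro: conv_comm)

section \<open>The comultiplication \<open>\<theta>\<close> and the coalgebra axioms\<close>

abbreviation "circ \<equiv> alg.circ"

definition \<theta> :: "'a \<Rightarrow> 't"
  where "\<theta> x = \<Delta> (P x) - map2 Q id (\<Delta> x)"

lemma pair2_theta:
  assumes "f \<in> forms" "g \<in> forms"
  shows "pair2 f g (\<theta> x) = dual.circ f g x"
  using assms by (simp add: \<theta>_def dual.circ_def pair2_add_diff pair2_map2 linear_maps pair2_Delta)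

lemma pair2_delta:
  assumes "f \<in> forms" "g \<in> forms"
  shows "pair2 f g (delta_of \<theta> x) = dual.bracket f g x"
  using assms by (simp add: delta_of_def pair2_add_diff pair2_tau pair2_theta)

text \<open>The left sides are the merged forms that \<open>pair3_id_ten\<close> and
  \<open>pair3_ten_id\<close> produce; rewriting them as dual products lets the identities of
  \<open>dual\<close> apply.\<close>

lemma pair2_comp_comult:
  assumes "f \<in> forms" "g \<in> forms"
  shows "pair2 f g \<circ> \<Delta> = conv f g" "pair2 f g \<circ> \<theta> = dual.circ f g"
    "pair2 f g \<circ> delta_of \<theta> = dual.bracket f g"
  using assms by (auto simp: conv_def pair2_theta pair2_delta)

lemma linear_theta: "linear_comult \<theta>" "linear_comult (delta_of \<theta>)"
proof -
  have D: "Vector_Spaces.linear scale scale2 \<Delta>"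
    using linear_maps by (simp add: linear_comult_def)
  show *: "linear_comult \<theta>"
    unfolding linear_comult_def \<theta>_def
    by (intro linear_map_diff_maps linear_map_comp[OF _ D] linear_map_comp[OF D linear_map2] linear_maps)
  show "linear_comult (delta_of \<theta>)"
    using * linear_map_comp[OF _ linear_tau] unfolding linear_comult_def delta_of_def
    by (intro linear_map_diff_maps)
qed

lemmas coalgebra_simps = pair2_add_diff pair3_add_diff pair2_map2 pair2_tau pair3_id_ten pair3_ten_id
  pair3_xi pair3_tau_id pair3_map3 linear_maps linear_theta pair2_comp_comult pair2_Delta pair2_theta
  pair2_delta dual.circ_closed dual.closed

lemma anti_pre_Lie_coalgebra_theta: "anti_pre_Lie_coalgebra \<theta>"
  unfolding anti_pre_Lie_coalgebra_def Let_def
proof (intro conjI allI)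
  fix x
  show "id_ten \<theta> (\<theta> x) - tau_id (id_ten \<theta> (\<theta> x)) = tau_id (ten_id \<theta> (\<theta> x)) - ten_id \<theta> (\<theta> x)"
  proof (rule pair3_eqI)
    fix f g h assume fgh: "f \<in> forms" "g \<in> forms" "h \<in> forms"
    show "pair3 f g h (id_ten \<theta> (\<theta> x) - tau_id (id_ten \<theta> (\<theta> x)))
        = pair3 f g h (tau_id (ten_id \<theta> (\<theta> x)) - ten_id \<theta> (\<theta> x))"
      \<comment> \<open>The dual identity is an equation between forms; its value at
        \<open>x\<close> is the paired coalgebra axiom.\<close>
      using fgh fun_cong[OF dual.anti_pre_Lie[OF fgh], of x]
      by (simp add: coalgebra_simps dual.circ_diff)
  qed
  show "tau_id (ten_id \<theta> (\<theta> x)) - ten_id \<theta> (\<theta> x) + xi (tau_id (ten_id \<theta> (\<theta> x)) - ten_id \<theta> (\<theta> x))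
    + xi (xi (tau_id (ten_id \<theta> (\<theta> x)) - ten_id \<theta> (\<theta> x))) = 0"
  proof (rule pair3_eqI)
    fix f g h assume fgh: "f \<in> forms" "g \<in> forms" "h \<in> forms"
    show "pair3 f g h (tau_id (ten_id \<theta> (\<theta> x)) - ten_id \<theta> (\<theta> x)
        + xi (tau_id (ten_id \<theta> (\<theta> x)) - ten_id \<theta> (\<theta> x))
        + xi (xi (tau_id (ten_id \<theta> (\<theta> x)) - ten_id \<theta> (\<theta> x)))) = pair3 f g h 0"
      \<comment> \<open>The first difference pairs to minus \<open>circ\<close> of the bracket of
        \<open>f\<close> and \<open>g\<close> with \<open>h\<close>, in the dual; \<open>xi\<close>
        rotates the three forms, giving the negated cyclic sum.\<close>
      using fgh fun_cong[OF dual.anti_pre_Lie_cyclic[OF fgh], of x]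
      by (simp add: coalgebra_simps dual.circ_diff) (simp add: algebra_simps)
  qed
qed (rule linear_theta)

lemma relative_PCA_coalgebra_theta: "relative_PCA_coalgebra \<Delta> \<theta> Q P"
  unfolding relative_PCA_coalgebra_def Let_def
proof (intro conjI allI)
  show "cocomm_coassoc_coalgebra \<Delta>" "linear_endo Q" "linear_endo P"
    "\<Delta> (Q x) = map2 Q id (\<Delta> x) + map2 id Q (\<Delta> x)"
    "\<Delta> (P x) = map2 id P (\<Delta> x) - map2 Q id (\<Delta> x)" for x
    using bialgebra by (auto simp: comm_cocomm_diff_ASI_bialgebra_def
        admissible_cocomm_diff_coalgebra_def)
next
  show "delta_of \<theta> (Q x) = map2 Q id (delta_of \<theta> x) + map2 id Q (delta_of \<theta> x)" for x
  proof (rule pair2_eqI)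
    fix f g assume fg: "f \<in> forms" "g \<in> forms"
    show "pair2 f g (delta_of \<theta> (Q x)) = pair2 f g (map2 Q id (delta_of \<theta> x) + map2 id Q (delta_of \<theta> x))"
      using fg fun_cong[OF dual.P_bracket[OF fg], of x] by (simp add: coalgebra_simps)
  qed
  show "\<theta> (P x) = map2 id P (\<theta> x) - map2 Q id (\<theta> x)" for x
  proof (rule pair2_eqI)
    fix f g assume fg: "f \<in> forms" "g \<in> forms"
    show "pair2 f g (\<theta> (P x)) = pair2 f g (map2 id P (\<theta> x) - map2 Q id (\<theta> x))"
      using fg fun_cong[OF dual.circ_Q[OF fg], of x] by (simp add: coalgebra_simps)
  qed
next
  fix x
  show "id_ten \<Delta> (delta_of \<theta> x) - ten_id (delta_of \<theta>) (\<Delta> x) - tau_id (id_ten (delta_of \<theta>) (\<Delta> x))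
      - map3 Q id id (ten_id \<Delta> (\<Delta> x)) = 0"
  proof (rule pair3_eqI)
    fix f g h assume fgh: "f \<in> forms" "g \<in> forms" "h \<in> forms"
    show "pair3 f g h (id_ten \<Delta> (delta_of \<theta> x) - ten_id (delta_of \<theta>) (\<Delta> x)
        - tau_id (id_ten (delta_of \<theta>) (\<Delta> x)) - map3 Q id id (ten_id \<Delta> (\<Delta> x))) = pair3 f g h 0"
      \<comment> \<open>The forms are permuted because the first leg \<open>f\<close> brackets the
        product of \<open>g\<close> and \<open>h\<close>.\<close>
      using fgh fun_cong[OF dual.relative_Leibniz[OF fgh(2,3,1)], of x]
      by (simp add: coalgebra_simps dual.comm dual.left_commute)
  qed
  show "id_ten \<theta> (\<Delta> x) - tau_id (id_ten \<Delta> (\<theta> x)) + ten_id (delta_of \<theta>) (\<Delta> x)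
      - map3 id Q id (ten_id \<Delta> (\<Delta> x)) = 0"
  proof (rule pair3_eqI)
    fix f g h assume fgh: "f \<in> forms" "g \<in> forms" "h \<in> forms"
    show "pair3 f g h (id_ten \<theta> (\<Delta> x) - tau_id (id_ten \<Delta> (\<theta> x)) + ten_id (delta_of \<theta>) (\<Delta> x)
      - map3 id Q id (ten_id \<Delta> (\<Delta> x))) = pair3 f g h 0"
      using fgh fun_cong[OF dual.mul_circ[OF fgh], of x]
      by (simp add: coalgebra_simps)
  qed
  show "ten_id \<Delta> (\<theta> x) = tau_id (id_ten \<Delta> (\<theta> x)) + id_ten \<Delta> (\<theta> x) - ten_id \<Delta> (\<Delta> (P x))"
  proof (rule pair3_eqI)
    fix f g h assume fgh: "f \<in> forms" "g \<in> forms" "h \<in> forms"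
    show "pair3 f g h (ten_id \<Delta> (\<theta> x))
        = pair3 f g h (tau_id (id_ten \<Delta> (\<theta> x)) + id_ten \<Delta> (\<theta> x) - ten_id \<Delta> (\<Delta> (P x)))"
      \<comment> \<open>The outer \<open>Q\<close> of \<open>circ_mul\<close> is composition with
        \<open>P\<close> in the dual, whence the term with \<open>P x\<close>.\<close>
      using fgh fun_cong[OF dual.circ_mul[OF fgh], of x]
      by (simp add: coalgebra_simps algebra_simps)
  qed
qed (rule anti_pre_Lie_coalgebra_theta)

section \<open>The relative PCA algebra\<close>

lemma bilinear_circ: "bilinear_map scale scale circ"
  unfolding bilinear_map_def alg.circ_def
  by (intro conjI allI linear_map_diff_maps linear_map_comp[OF _ linear_maps(2)]
      linear_map_comp[OF linear_maps(1)] linear_maps)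

lemma relative_PCA_algebra_circ: "relative_PCA_algebra mul circ P Q"
proof -
  have "comm_assoc_algebra mul" "derivation mul P" "linear_endo P" "linear_endo Q"
    "\<And>x y. mul x (Q y) - mul (P x) y - Q (mul x y) = 0"
    using bialgebra by (auto simp: comm_cocomm_diff_ASI_bialgebra_def
        admissible_comm_diff_algebra_def derivation_def)
  moreover have "anti_pre_Lie_algebra circ"
    using bilinear_circ alg.anti_pre_Lie alg.anti_pre_Lie_cyclic
    by (simp add: anti_pre_Lie_algebra_def commutator_def)
  moreover have "lie_algebra (commutator circ)"
    using bilinear_circ alg.Jacobi
    by (auto simp: lie_algebra_def commutator_def[abs_def] bilinear_map_def intro!: linear_map_diff_maps)
  moreover have "derivation (commutator circ) P"
    using alg.P_bracket linear_maps by (simp add: derivation_def commutator_def linear_endo_def)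
  moreover have "relative_Poisson_algebra mul (commutator circ) P"
    using calculation alg.relative_Leibniz by (simp add: relative_Poisson_algebra_def commutator_def)
  ultimately show ?thesis
    using alg.circ_Q alg.mul_circ alg.circ_mul
    by (simp add: relative_PCA_algebra_def commutator_def)
qed

section \<open>Compatibility of the products with the comultiplications\<close>

lemma linear_circ:
  "Vector_Spaces.linear scale scale (circ x)" "Vector_Spaces.linear scale scale (\<lambda>y. circ y x)"
  "Vector_Spaces.linear scale scale (commutator circ x)"
  using bilinear_circ
  by (auto simp: commutator_def[abs_def] bilinear_map_def intro!: linear_map_diff_maps)

text \<open>Since \<open>x \<cdot> y = y \<cdot> x\<close>, the two expansions of \<open>\<Delta>(x \<cdot> y)\<close> agree.\<close>

lemma conv_swap:
  assumes "f \<in> forms" "g \<in> forms"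
  shows "conv (f \<circ> mul x) g y = conv (f \<circ> mul y) g x + conv f (g \<circ> mul x) y - conv f (g \<circ> mul y) x"
  using conv_mul[OF assms, of x y] conv_mul[OF assms, of y x] alg.comm[of x y] by simp

text \<open>Admissibility transposed: \<open>Q\<close> moves past the multiplication until it sits
  next to the form.\<close>

lemma comp_mul_Q: "f \<in> forms \<Longrightarrow> f \<circ> mul x \<circ> Q = (f \<circ> mul (P x)) + (f \<circ> Q \<circ> mul x)"
  by (auto simp: alg.mul_Q form_add)

lemma comp_circ:
  assumes "f \<in> forms"
  shows "f \<circ> circ x = (f \<circ> Q \<circ> mul x) - (f \<circ> mul (P x))"
    and "f \<circ> (\<lambda>y. circ y x) = (f \<circ> Q \<circ> mul x) - (f \<circ> mul x \<circ> P)"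
    and "f \<circ> commutator circ x = (f \<circ> mul x \<circ> P) - (f \<circ> mul (P x))"
  using assms by (auto simp: alg.circ_def form_diff alg.comm alg.bracket_eq commutator_def)

lemma conv_add_diff:
  assumes "f \<in> forms" "g \<in> forms"
  shows "conv f g (x + y) = conv f g x + conv f g y" "conv f g (x - y) = conv f g x - conv f g y"
  using conv_closed[OF assms] by (simp_all add: form_add form_diff)

lemma conv_circ:
  assumes "f \<in> forms" "g \<in> forms"
  shows "conv f g (circ x y) = conv f g (Q (mul x y)) - conv f g (mul (P x) y)"
  by (simp add: alg.circ_def conv_add_diff assms)

lemma commutator_circ: "commutator circ x y = mul x (P y) - mul y (P x)"
  by (simp add: commutator_def alg.bracket_eq)

text \<open>These rules collect every \<open>Q\<close> on the forms and every \<open>P\<close> on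
  the elements: \<open>conv_Q\<close> moves \<open>Q\<close> off the argument,
  \<open>dual.mul_Q\<close> and \<open>dual.Q_mul\<close> move \<open>P\<close> off the forms.
  Products in the argument are expanded by \<open>conv_mul\<close>.\<close>

lemmas conv_simps = conv_circ commutator_circ conv_add_diff pair2_add_diff pair2_map2 pair2_tau
  linear_maps linear_circ forms_comp forms_add_diff pair2_Delta dual.circ_def pair2_theta pair2_delta
  comp_circ comp_mul_Q dual.diff dual.distrib_left dual.add conv_Q conv_mul dual.mul_Q dual.Q_mul
  alg.P_mul

lemma theta_mul:
  "\<theta> (mul x y) + map2 (circ y) id (\<Delta> x) - map2 id (mul x) (\<theta> y)
    + map2 (circ x) id (\<Delta> y) - map2 id (mul y) (\<theta> x) - map2 Q id (\<Delta> (mul x y)) = 0"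
  (is "?t = 0")
proof (rule pair2_eqI)
  fix f g assume "f \<in> forms" "g \<in> forms"
  then show "pair2 f g ?t = pair2 f g 0"
    \<comment> \<open>Every term carries exactly one \<open>P\<close> or \<open>Q\<close>. What
      survives normalization cancels by swaps of the same degree, with the operator on
      \<open>y\<close> or on \<open>f\<close>.\<close>
    using conv_swap[of f g x "P y"] conv_swap[of "f \<circ> Q" g x y]
    by (simp add: conv_simps)
qed

lemma Delta_circ:
  "\<Delta> (circ x y) + (tau (map2 id (mul y) (\<theta> x)) + map2 id (mul y) (\<theta> x))
    - (map2 id (circ x) (\<Delta> y) + map2 (circ x) id (\<Delta> y)) - \<Delta> (mul (P x) y) = 0"
  (is "?t = 0")
proof (rule pair2_eqI)
  fix f g assume "f \<in> forms" "g \<in> forms"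
  then show "pair2 f g ?t = pair2 f g 0"
    using conv_swap[of f g "P x" y] conv_swap[of f "g \<circ> Q" x y]
    \<comment> \<open>The flip \<open>tau\<close> puts \<open>g\<close> in the first leg; the
      instances of \<open>dual.comm\<close> bring it back to the second.\<close>
    by (simp add: conv_simps dual.comm[of g] dual.comm[of "g \<circ> Q"])
qed

lemma Delta_commutator:
  "(map2 (mul x) id (\<theta> y) - map2 id (mul x) (\<theta> y))
    + (map2 (circ y) id (\<Delta> x) - map2 id (commutator circ y) (\<Delta> x))
    - \<Delta> (commutator circ x y) + \<Delta> (mul x (P y)) = 0"
  (is "?t = 0")
proof (rule pair2_eqI)
  fix f g assume "f \<in> forms" "g \<in> forms"
  then show "pair2 f g ?t = pair2 f g 0"
    using conv_swap[of f g "P x" y] conv_swap[of f g x "P y"] conv_swap[of "f \<circ> Q" g x y]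
    by (simp add: conv_simps)
qed

lemma delta_mul:
  "map2 id (\<lambda>z. circ z y) (\<Delta> x) + map2 (mul x) id (delta_of \<theta> y) - map2 id (circ x) (\<Delta> y)
    + tau (map2 id (mul y) (\<theta> x)) - delta_of \<theta> (mul x y) + map2 id Q (\<Delta> (mul x y)) = 0"
  (is "?t = 0")
proof (rule pair2_eqI)
  fix f g assume "f \<in> forms" "g \<in> forms"
  then show "pair2 f g ?t = pair2 f g 0"
    \<comment> \<open>All four places for a single operator occur: \<open>P\<close> on
      \<open>x\<close> or \<open>y\<close>, \<open>Q\<close> on \<open>f\<close> or
      \<open>g\<close>.\<close>
    using conv_swap[of f g "P x" y] conv_swap[of f g x "P y"]
      conv_swap[of "f \<circ> Q" g x y] conv_swap[of f "g \<circ> Q" x y]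
    by (simp add: conv_simps dual.comm[of g] dual.comm[of "g \<circ> Q"] dual.comm[of "g \<circ> mul z" for z]
        dual.comm[of "g \<circ> Q \<circ> mul z" for z])
qed

lemma anti_pre_Lie_compatible_theta: "anti_pre_Lie_compatible circ \<theta>"
  unfolding anti_pre_Lie_compatible_def Let_def
proof (intro conjI allI)
  fix x y
  let ?w = "\<theta> (circ x y) - map2 (circ x) id (\<theta> y) - map2 id (circ x) (\<theta> y)
    + map2 id (\<lambda>z. circ z y) (\<theta> x)"
  show "?w - tau ?w = 0"
  proof (rule pair2_eqI)
    fix f g assume "f \<in> forms" "g \<in> forms"
    then show "pair2 f g (?w - tau ?w) = pair2 f g 0"
      \<comment> \<open>Both \<open>\<theta>\<close> and \<open>circ\<close> contribute one
        operator, so the swaps needed here carry two: each has \<open>P\<close> only on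
        \<open>x\<close>, and \<open>Q\<close> on either form.\<close>
      using conv_swap[of f g "P (P x)" y] conv_swap[of "f \<circ> Q" g "P x" y]
        conv_swap[of f "g \<circ> Q" "P x" y] conv_swap[of "f \<circ> Q" "g \<circ> Q" x y]
        conv_swap[of f "g \<circ> Q \<circ> Q" x y]
      by (simp add: conv_simps dual.comm[of g] dual.comm[of "g \<circ> Q"] dual.comm[of "g \<circ> Q \<circ> Q"]
          dual.comm[of "g \<circ> mul z" for z] dual.comm[of "g \<circ> Q \<circ> mul z" for z]
          dual.comm[of "g \<circ> Q \<circ> Q \<circ> mul z" for z])
  qed
next
  fix x y
  show "\<theta> (commutator circ x y) = (map2 id (commutator circ x) (\<theta> y) - map2 (circ x) id (\<theta> y))
      - (map2 id (commutator circ y) (\<theta> x) - map2 (circ y) id (\<theta> x))"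
    (is "?l = ?r")
  proof (rule pair2_eqI)
    fix f g assume "f \<in> forms" "g \<in> forms"
    then show "pair2 f g ?l = pair2 f g ?r"
      using conv_swap[of f g x "P (P y)"] conv_swap[of f g y "P (P x)"] conv_swap[of f g "P x" "P y"]
        conv_swap[of "f \<circ> Q" g x "P y"] conv_swap[of "f \<circ> Q" g y "P x"]
        conv_swap[of "f \<circ> Q \<circ> Q" g x y]
      \<comment> \<open>\<open>alg.diff\<close> splits \<open>P\<close> applied to the commutator,
        which is a difference of products.\<close>
      by (simp add: conv_simps alg.diff)
  qed
qed

theorem relative_PCA_bialgebra_theta: "relative_PCA_bialgebra mul circ \<Delta> \<theta> P Q"
proof -
  have "comm_cocomm_ASI_bialgebra mul \<Delta>"
    using bialgebra by (simp add: comm_cocomm_diff_ASI_bialgebra_def)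
  then show ?thesis
    unfolding relative_PCA_bialgebra_def Let_def
    using relative_PCA_algebra_circ relative_PCA_coalgebra_theta anti_pre_Lie_compatible_theta
      theta_mul Delta_circ Delta_commutator delta_mul
    by blast
qed

end

theorem proposition3p12:
  fixes scale :: "'k::{alg_closed_field, field_char_0} \<Rightarrow> 'a::ab_group_add \<Rightarrow> 'a"
    and Basis :: "'a set"
    and scale2 :: "'k \<Rightarrow> 't::ab_group_add \<Rightarrow> 't"
    and scale3 :: "'k \<Rightarrow> 'u::ab_group_add \<Rightarrow> 'u"
    and tens2 :: "'a \<Rightarrow> 'a \<Rightarrow> 't"
    and tens3 :: "'a \<Rightarrow> 'a \<Rightarrow> 'a \<Rightarrow> 'u"
    and mul circ :: "'a \<Rightarrow> 'a \<Rightarrow> 'a"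
    and \<Delta> \<theta> :: "'a \<Rightarrow> 't"
    and P Q :: "'a \<Rightarrow> 'a"
  assumes "tensor_powers scale Basis scale2 scale3 tens2 tens3"
    and "tensor_powers.comm_cocomm_diff_ASI_bialgebra scale scale2 scale3 tens2 tens3 mul \<Delta> P Q"
    and "\<And>x y. circ x y = Q (mul x y) - mul (P x) y"
    and "\<And>x. \<theta> x = \<Delta> (P x) - tensor_powers.map2 scale2 tens2 Q id (\<Delta> x)"
  shows "tensor_powers.relative_PCA_bialgebra scale scale2 scale3 tens2 tens3 mul circ \<Delta> \<theta> P Q"
proof -
  interpret B: diff_ASI_bialgebra scale Basis scale2 scale3 tens2 tens3 mul \<Delta> P Q
    using assms(1,2) by (simp add: diff_ASI_bialgebra_def diff_ASI_bialgebra_axioms_def)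
  have "circ = B.circ" "\<theta> = B.\<theta>"
    by (simp_all add: fun_eq_iff assms(3,4) B.alg.circ_def B.\<theta>_def)
  then show ?thesis
    using B.relative_PCA_bialgebra_theta by simp
qed

end
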